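(* Let $(R,\mathfrak{m})$ be a complete Noetherian local ring with residue field $k$ and $E=E_R(k)$, and let $I$ be an ideal of $R$ satisfying $\mathrm{core}(I)=(J^{n+1}:_R I^n)$ for some reduction $J$ of $I$ and some natural number $n$. Then $$\mathrm{hull}^E(0:_E I)=I^n\,(0:_E J^{n+1}).$$
   Context: $E=E_R(k)$ is the injective hull of $k$ and $(-)^\vee=\mathrm{Hom}_R(-,E)$; by Matlis duality $E^\vee=R$, $R^\vee=E$, and for $A\subseteq E$, $(E/A)^\vee=(0:_R A)\subseteq R$. For an ideal $K$, $(0:_E K)=\{e\in E:Ke=0\}$. A reduction of $I$ is an ideal $J\subseteq I$ such that $I^{s+1}=JI^s$ for some (equivalently all large) $s$; equivalently $J\subseteq I$ have the same integral closure. $\mathrm{core}(I)$ is the intersection of all reductions of $I$. The integral interior of a submodule $A\subseteq E$ is the dual of integral closure: $A^E_{-}:=\left(E^\vee/\left((E/A)^\vee\right)^{-}_{E^\vee}\right)^\vee=\left(R/\overline{(0:_R A)}\right)^\vee=0:_E\overline{(0:_R A)}$, where $\overline{K}$ is the integral closure of the ideal $K$. $\mathrm{hull}^E(A)$ is the integral hull of $A$ in $E$: the sum of all submodules $C$ with $A\subseteq C\subseteq E$ and $C^E_{-}=A^E_{-}$. *)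

theory Defs
  imports "HOL-Algebra.Algebra"
begin

section \<open>Modules, injectivity and injective hulls\<close>

definition mod_hom ::
    "('a, 'r) ring_scheme \<Rightarrow> ('a, 'b, 'm) module_scheme \<Rightarrow> ('a, 'c, 'n) module_scheme \<Rightarrow> ('b \<Rightarrow> 'c) set"
  where "mod_hom R M N =
    {h \<in> carrier M \<rightarrow> carrier N.
       (\<forall>x \<in> carrier M. \<forall>y \<in> carrier M. h (x \<oplus>\<^bsub>M\<^esub> y) = h x \<oplus>\<^bsub>N\<^esub> h y) \<and>
       (\<forall>r \<in> carrier R. \<forall>x \<in> carrier M. h (r \<odot>\<^bsub>M\<^esub> x) = r \<odot>\<^bsub>N\<^esub> h x)}"

text \<open>A HOL definition cannot quantify over the types carrying the test modules, so the type
  \<open>'c\<close> of their elements is a parameter. As soon as this type can carry the ring itself, the notion no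
  longer depends on it: this is Baer's criterion, proved below as
  \<open>injective_module_any_type\<close>. This is why \<open>injective_hull\<close> may use the ring's own type.\<close>

definition injective_module ::
    "'c itself \<Rightarrow> ('a, 'r) ring_scheme \<Rightarrow> ('a, 'b, 'e) module_scheme \<Rightarrow> bool"
  where "injective_module (_ :: 'c itself) R E \<longleftrightarrow>
    module R E \<and>
    (\<forall>(M :: ('a, 'c) module) (N :: ('a, 'c) module) f g.
       module R M \<longrightarrow> module R N \<longrightarrow> f \<in> mod_hom R M N \<longrightarrow> inj_on f (carrier M) \<longrightarrow>
       g \<in> mod_hom R M E \<longrightarrow>
       (\<exists>h \<in> mod_hom R N E. \<forall>x \<in> carrier M. h (f x) = g x))"

definition essential_mono ::
    "('a, 'r) ring_scheme \<Rightarrow> ('a, 'b, 'm) module_scheme \<Rightarrow> ('a, 'c, 'n) module_scheme \<Rightarrow> ('b \<Rightarrow> 'c) \<Rightarrow> bool"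
  where "essential_mono R K E \<iota> \<longleftrightarrow>
    \<iota> \<in> mod_hom R K E \<and> inj_on \<iota> (carrier K) \<and>
    (\<forall>N. submodule N R E \<longrightarrow> N \<noteq> {\<zero>\<^bsub>E\<^esub>} \<longrightarrow> N \<inter> \<iota> ` carrier K \<noteq> {\<zero>\<^bsub>E\<^esub>})"

definition injective_hull ::
    "('a, 'r) ring_scheme \<Rightarrow> ('a, 'b, 'm) module_scheme \<Rightarrow> ('a, 'c, 'n) module_scheme \<Rightarrow> bool"
  where "injective_hull R K E \<longleftrightarrow>
    module R K \<and> injective_module TYPE('a) R E \<and> (\<exists>\<iota>. essential_mono R K E \<iota>)"

definition submodule_generated ::
    "('a, 'r) ring_scheme \<Rightarrow> ('a, 'b, 'm) module_scheme \<Rightarrow> 'b set \<Rightarrow> 'b set"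
  where "submodule_generated R M S = \<Inter>{N. submodule N R M \<and> S \<subseteq> N}"

definition ideal_smult ::
    "('a, 'r) ring_scheme \<Rightarrow> ('a, 'b, 'm) module_scheme \<Rightarrow> 'a set \<Rightarrow> 'b set \<Rightarrow> 'b set"
  where "ideal_smult R M K N = submodule_generated R M {a \<odot>\<^bsub>M\<^esub> x | a x. a \<in> K \<and> x \<in> N}"

definition mod_ann ::
    "('a, 'r) ring_scheme \<Rightarrow> ('a, 'b, 'm) module_scheme \<Rightarrow> 'a set \<Rightarrow> 'b set"
  where "mod_ann R M K = {x \<in> carrier M. \<forall>a \<in> K. a \<odot>\<^bsub>M\<^esub> x = \<zero>\<^bsub>M\<^esub>}"

definition ring_ann ::
    "('a, 'r) ring_scheme \<Rightarrow> ('a, 'b, 'm) module_scheme \<Rightarrow> 'b set \<Rightarrow> 'a set"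
  where "ring_ann R M A = {a \<in> carrier R. \<forall>x \<in> A. a \<odot>\<^bsub>M\<^esub> x = \<zero>\<^bsub>M\<^esub>}"


section \<open>Complete Noetherian local rings\<close>

text \<open>The power \<open>K\<^sup>n\<close> is taken in the library's monoid of ideals under the ideal product;
  in particular \<open>K\<^sup>0 = R\<close>.\<close>

abbreviation ideal_pow :: "('a, 'r) ring_scheme \<Rightarrow> 'a set \<Rightarrow> nat \<Rightarrow> 'a set"
  where "ideal_pow R K n \<equiv> K [^]\<^bsub>ideals_set R\<^esub> n"

definition adic_cauchy :: "('a, 'r) ring_scheme \<Rightarrow> 'a set \<Rightarrow> (nat \<Rightarrow> 'a) \<Rightarrow> bool"
  where "adic_cauchy R K s \<longleftrightarrow>
    (\<forall>n. \<exists>N. \<forall>i \<ge> N. \<forall>j \<ge> N. s i \<ominus>\<^bsub>R\<^esub> s j \<in> ideal_pow R K n)"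

definition adic_limit :: "('a, 'r) ring_scheme \<Rightarrow> 'a set \<Rightarrow> (nat \<Rightarrow> 'a) \<Rightarrow> 'a \<Rightarrow> bool"
  where "adic_limit R K s x \<longleftrightarrow>
    (\<forall>n. \<exists>N. \<forall>i \<ge> N. s i \<ominus>\<^bsub>R\<^esub> x \<in> ideal_pow R K n)"

definition adic_complete :: "('a, 'r) ring_scheme \<Rightarrow> 'a set \<Rightarrow> bool"
  where "adic_complete R K \<longleftrightarrow>
    (\<Inter>n. ideal_pow R K n) = {\<zero>\<^bsub>R\<^esub>} \<and>
    (\<forall>s. range s \<subseteq> carrier R \<longrightarrow> adic_cauchy R K s \<longrightarrow> (\<exists>x \<in> carrier R. adic_limit R K s x))"

locale complete_noetherian_local_ring = cring R + noetherian_ring R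
  for R :: "('a, 'r) ring_scheme" (structure) and \<mm> :: "'a set" +
  assumes maximal: "maximalideal \<mm> R"
    and unique_maximal: "maximalideal \<nn> R \<Longrightarrow> \<nn> = \<mm>"
    and complete: "adic_complete R \<mm>"

definition residue_module :: "('a, 'r) ring_scheme \<Rightarrow> 'a set \<Rightarrow> ('a, 'a set) module"
  where "residue_module R \<mm> =
    \<lparr>carrier = carrier (R Quot \<mm>), monoid.mult = monoid.mult (R Quot \<mm>), monoid.one = monoid.one (R Quot \<mm>),
     ring.zero = ring.zero (R Quot \<mm>), ring.add = ring.add (R Quot \<mm>),
     smult = (\<lambda>r c. (\<mm> +>\<^bsub>R\<^esub> r) \<otimes>\<^bsub>R Quot \<mm>\<^esub> c)\<rparr>"

lemma residue_module_module:
  fixes R (structure)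
  assumes "cring R" "ideal K R" shows "module R (residue_module R K)"
proof -
  interpret cring R by fact
  interpret I: ideal K R by fact
  interpret h: ring_hom_ring R "R Quot K" "(+>) K" by (rule I.rcos_ring_hom_ring)
  have "abelian_group (residue_module R K)"
    by (rule abelian_groupI)
      (auto simp: residue_module_def h.S.a_ac intro: bexI[of _ "\<ominus>\<^bsub>R Quot K\<^esub> _"] h.S.l_neg)
  then show ?thesis
    by (intro moduleI)
      (auto simp: residue_module_def assms h.S.l_distr h.S.r_distr h.S.m_assoc h.hom_one[symmetric]
         simp del: h.hom_one, auto)
qed


section \<open>Reductions, core, integral closure and integral hull\<close>

definition reduction :: "('a, 'r) ring_scheme \<Rightarrow> 'a set \<Rightarrow> 'a set \<Rightarrow> bool"
  where "reduction R J I \<longleftrightarrow>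
    ideal J R \<and> J \<subseteq> I \<and> (\<exists>s. ideal_pow R I (s + 1) = J \<cdot>\<^bsub>R\<^esub> ideal_pow R I s)"

definition core :: "('a, 'r) ring_scheme \<Rightarrow> 'a set \<Rightarrow> 'a set"
  where "core R I = \<Inter>{J. reduction R J I}"

definition ideal_colon :: "('a, 'r) ring_scheme \<Rightarrow> 'a set \<Rightarrow> 'a set \<Rightarrow> 'a set"
  where "ideal_colon R K L = {r \<in> carrier R. \<forall>x \<in> L. r \<otimes>\<^bsub>R\<^esub> x \<in> K}"

definition integral_closure :: "('a, 'r) ring_scheme \<Rightarrow> 'a set \<Rightarrow> 'a set"
  where "integral_closure R K =
    {x \<in> carrier R. \<exists>n \<ge> 1. \<exists>a. (\<forall>i \<in> {1..n}. a i \<in> ideal_pow R K i) \<and>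
       x [^]\<^bsub>R\<^esub> n \<oplus>\<^bsub>R\<^esub> (\<Oplus>\<^bsub>R\<^esub>i \<in> {1..n}. a i \<otimes>\<^bsub>R\<^esub> x [^]\<^bsub>R\<^esub> (n - i)) = \<zero>\<^bsub>R\<^esub>}"

text \<open>For \<open>E\<close> the injective hull of the residue field of a complete Noetherian local ring, Matlis
  duality identifies \<open>Hom(E, E)\<close> with \<open>R\<close> and \<open>Hom(E/A, E)\<close> with the annihilator of \<open>A\<close> in \<open>R\<close>; the
  dual of integral closure is then the following submodule of \<open>E\<close>.\<close>

definition integral_interior ::
    "('a, 'r) ring_scheme \<Rightarrow> ('a, 'b, 'e) module_scheme \<Rightarrow> 'b set \<Rightarrow> 'b set"
  where "integral_interior R E A = mod_ann R E (integral_closure R (ring_ann R E A))"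

definition integral_hull ::
    "('a, 'r) ring_scheme \<Rightarrow> ('a, 'b, 'e) module_scheme \<Rightarrow> 'b set \<Rightarrow> 'b set"
  where "integral_hull R E A =
    submodule_generated R E
      (\<Union>{C. submodule C R E \<and> A \<subseteq> C \<and> integral_interior R E C = integral_interior R E A})"


section \<open>Injectivity does not depend on the type of the test modules\<close>

definition regular_module :: "('a, 'r) ring_scheme \<Rightarrow> ('a, 'a) module"
  where "regular_module R =
    \<lparr>carrier = carrier R, monoid.mult = monoid.mult R, monoid.one = monoid.one R,
     ring.zero = ring.zero R, ring.add = ring.add R, smult = monoid.mult R\<rparr>"

lemma regular_module_module:
  fixes R (structure)
  assumes "cring R" shows "module R (regular_module R)"
proof -
  interpret cring R by fact
  have "abelian_group (regular_module R)"
    by (rule abelian_groupI) (auto simp: regular_module_def a_ac intro: bexI[of _ "\<ominus> _"] l_neg)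
  then show ?thesis
    by (intro moduleI) (auto simp: regular_module_def assms l_distr r_distr m_assoc)
qed

lemma injective_module_Baer:
  fixes R (structure) and E :: "('a, 'b, 'e) module_scheme"
  assumes inj: "injective_module TYPE('a) R E" and I: "ideal I R"
    and ph: "\<phi> \<in> I \<rightarrow> carrier E"
    and add: "\<And>x y. x \<in> I \<Longrightarrow> y \<in> I \<Longrightarrow> \<phi> (x \<oplus> y) = \<phi> x \<oplus>\<^bsub>E\<^esub> \<phi> y"
    and sm: "\<And>r x. r \<in> carrier R \<Longrightarrow> x \<in> I \<Longrightarrow> \<phi> (r \<otimes> x) = r \<odot>\<^bsub>E\<^esub> \<phi> x"
  shows "\<exists>e \<in> carrier E. \<forall>x \<in> I. \<phi> x = x \<odot>\<^bsub>E\<^esub> e"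
proof -
  interpret E: module R E using inj by (simp add: injective_module_def)
  interpret I: ideal I R by fact
  let ?N = "regular_module R"
  let ?M = "?N\<lparr>carrier := I\<rparr>"
  interpret N: module R ?N by (rule regular_module_module) unfold_locales
  have "submodule I R ?N"
  proof (rule N.submoduleI)
    fix a assume a: "a \<in> I"
    then have ac: "a \<in> carrier R" using I.a_subset by auto
    have "\<ominus>\<^bsub>?N\<^esub> a = \<ominus> \<one> \<odot>\<^bsub>?N\<^esub> a"
      using N.smult_l_minus[of \<one> a] N.smult_one[of a] ac by (simp add: regular_module_def)
    also have "\<dots> \<in> I" using I.I_l_closed[OF a, of "\<ominus> \<one>"] by (simp add: regular_module_def)
    finally show "\<ominus>\<^bsub>?N\<^esub> a \<in> I" .
  qed (use I.a_subset I.I_l_closed in \<open>auto simp: regular_module_def\<close>)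
  then have M: "module R ?M" by (rule submodule.submodule_is_module) unfold_locales
  have f: "(\<lambda>x. x) \<in> mod_hom R ?M ?N" "inj_on (\<lambda>x. x) (carrier ?M)"
    using I.a_subset by (auto simp: mod_hom_def regular_module_def)
  have g: "\<phi> \<in> mod_hom R ?M E" using ph add sm by (auto simp: mod_hom_def regular_module_def)
  obtain h where h: "h \<in> mod_hom R ?N E" "\<forall>x \<in> carrier ?M. h x = \<phi> x"
    using inj M N.module_axioms f g unfolding injective_module_def by blast
  have "h \<one> \<in> carrier E" using h(1) by (auto simp: mod_hom_def regular_module_def)
  moreover have "\<phi> x = x \<odot>\<^bsub>E\<^esub> h \<one>" if "x \<in> I" for x
  proof -
    have x: "x \<in> carrier R" using that I.a_subset by auto
    have "\<forall>r \<in> carrier R. \<forall>x \<in> carrier R. h (r \<otimes> x) = r \<odot>\<^bsub>E\<^esub> h x"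
      using h(1) by (auto simp: mod_hom_def regular_module_def)
    then have "h (x \<otimes> \<one>) = x \<odot>\<^bsub>E\<^esub> h \<one>" using x by blast
    then show ?thesis using h(2) that x by (simp add: regular_module_def)
  qed
  ultimately show ?thesis by blast
qed

theorem injective_module_any_type:
  fixes R (structure) and E :: "('a, 'b, 'e) module_scheme"
  assumes inj: "injective_module TYPE('a) R E"
  shows "injective_module TYPE('c) R E"
  unfolding injective_module_def
proof (intro conjI allI impI)
  show Emod: "module R E" using inj by (simp add: injective_module_def)
  interpret E: module R E by fact
  fix M N :: "('a, 'c) module" and f g
  assume "module R M" "module R N" and f: "f \<in> mod_hom R M N" "inj_on f (carrier M)"
    and g: "g \<in> mod_hom R M E"
  interpret M: module R M by fact
  interpret N: module R N by fact
  have fc: "f x \<in> carrier N" "g x \<in> carrier E" if "x \<in> carrier M" for x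
    using that f g by (auto simp: mod_hom_def)
  define good where "good G \<longleftrightarrow> G \<subseteq> carrier N \<times> carrier E \<and>
      (\<forall>s t s' t'. (s, t) \<in> G \<longrightarrow> (s', t') \<in> G \<longrightarrow> (s \<oplus>\<^bsub>N\<^esub> s', t \<oplus>\<^bsub>E\<^esub> t') \<in> G) \<and>
      (\<forall>r \<in> carrier R. \<forall>s t. (s, t) \<in> G \<longrightarrow> (r \<odot>\<^bsub>N\<^esub> s, r \<odot>\<^bsub>E\<^esub> t) \<in> G) \<and>
      (\<forall>t. (\<zero>\<^bsub>N\<^esub>, t) \<in> G \<longrightarrow> t = \<zero>\<^bsub>E\<^esub>) \<and> (\<forall>x \<in> carrier M. (f x, g x) \<in> G)" for G
  define G0 where "G0 = (\<lambda>x. (f x, g x)) ` carrier M"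
  have f0: "f \<zero>\<^bsub>M\<^esub> = \<zero>\<^bsub>N\<^esub>" "g \<zero>\<^bsub>M\<^esub> = \<zero>\<^bsub>E\<^esub>"
  proof -
    have "f (\<zero> \<odot>\<^bsub>M\<^esub> \<zero>\<^bsub>M\<^esub>) = \<zero> \<odot>\<^bsub>N\<^esub> f \<zero>\<^bsub>M\<^esub>" "g (\<zero> \<odot>\<^bsub>M\<^esub> \<zero>\<^bsub>M\<^esub>) = \<zero> \<odot>\<^bsub>E\<^esub> g \<zero>\<^bsub>M\<^esub>"
      using f g unfolding mod_hom_def by blast+
    then show "f \<zero>\<^bsub>M\<^esub> = \<zero>\<^bsub>N\<^esub>" "g \<zero>\<^bsub>M\<^esub> = \<zero>\<^bsub>E\<^esub>" using fc[of "\<zero>\<^bsub>M\<^esub>"] by simp_all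
  qed
  have "good G0"
    unfolding good_def
  proof (intro conjI allI impI ballI)
    show "G0 \<subseteq> carrier N \<times> carrier E" using fc by (auto simp: G0_def)
  next
    fix s t s' t' assume "(s, t) \<in> G0" "(s', t') \<in> G0"
    then obtain x y where "x \<in> carrier M" "y \<in> carrier M" "s = f x" "t = g x" "s' = f y" "t' = g y"
      by (auto simp: G0_def)
    then show "(s \<oplus>\<^bsub>N\<^esub> s', t \<oplus>\<^bsub>E\<^esub> t') \<in> G0"
      using f(1) g unfolding G0_def mod_hom_def by (intro image_eqI[of _ _ "x \<oplus>\<^bsub>M\<^esub> y"]) auto
  next
    fix r s t assume "r \<in> carrier R" "(s, t) \<in> G0"
    then show "(r \<odot>\<^bsub>N\<^esub> s, r \<odot>\<^bsub>E\<^esub> t) \<in> G0"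
      using f(1) g unfolding G0_def mod_hom_def
      by (auto intro!: image_eqI[of _ _ "r \<odot>\<^bsub>M\<^esub> _"])
  next
    fix t assume "(\<zero>\<^bsub>N\<^esub>, t) \<in> G0"
    then obtain x where "x \<in> carrier M" "f x = \<zero>\<^bsub>N\<^esub>" "t = g x" by (auto simp: G0_def)
    then show "t = \<zero>\<^bsub>E\<^esub>" using f(2) f0 inj_onD[OF f(2), of x "\<zero>\<^bsub>M\<^esub>"] by simp
  qed (auto simp: G0_def)
  have chain: "\<Union>C \<in> Collect good" if "C \<noteq> {}" "subset.chain (Collect good) C" for C
  proof -
    have gd: "good G" if "G \<in> C" for G using that \<open>subset.chain _ C\<close> by (auto simp: subset.chain_def)
    have dir: "A \<subseteq> B \<or> B \<subseteq> A" if "A \<in> C" "B \<in> C" for A B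
      using that \<open>subset.chain _ C\<close> by (auto simp: subset_chain_def)
    have "(s \<oplus>\<^bsub>N\<^esub> s', t \<oplus>\<^bsub>E\<^esub> t') \<in> \<Union>C" if "(s, t) \<in> \<Union>C" "(s', t') \<in> \<Union>C" for s t s' t'
    proof -
      obtain A B where AB: "A \<in> C" "B \<in> C" "(s, t) \<in> A" "(s', t') \<in> B" using \<open>(s, t) \<in> \<Union>C\<close> \<open>(s', t') \<in> \<Union>C\<close> by blast
      then obtain D where "D \<in> C" "(s, t) \<in> D" "(s', t') \<in> D" using dir by blast
      then show ?thesis using gd unfolding good_def by blast
    qed
    moreover have "\<Union>C \<subseteq> carrier N \<times> carrier E" using gd unfolding good_def by blast
    moreover have "\<forall>r \<in> carrier R. \<forall>s t. (s, t) \<in> \<Union>C \<longrightarrow> (r \<odot>\<^bsub>N\<^esub> s, r \<odot>\<^bsub>E\<^esub> t) \<in> \<Union>C"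
      using gd unfolding good_def by blast
    moreover have "\<forall>t. (\<zero>\<^bsub>N\<^esub>, t) \<in> \<Union>C \<longrightarrow> t = \<zero>\<^bsub>E\<^esub>"
      using gd unfolding good_def by blast
    moreover have "\<forall>x \<in> carrier M. (f x, g x) \<in> \<Union>C"
      using gd \<open>C \<noteq> {}\<close> unfolding good_def by blast
    ultimately show ?thesis by (auto simp: good_def)
  qed
  obtain G where G: "good G" and max: "\<And>G'. good G' \<Longrightarrow> G \<subseteq> G' \<Longrightarrow> G' = G"
    using subset_Zorn_nonempty[of "Collect good"] \<open>good G0\<close> chain by blast
  have Gc: "s \<in> carrier N" "t \<in> carrier E" if "(s, t) \<in> G" for s t using that G by (auto simp: good_def)
  have Ga: "(s \<oplus>\<^bsub>N\<^esub> s', t \<oplus>\<^bsub>E\<^esub> t') \<in> G" if "(s, t) \<in> G" "(s', t') \<in> G" for s t s' t'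
    using that G unfolding good_def by blast
  have Gs: "(r \<odot>\<^bsub>N\<^esub> s, r \<odot>\<^bsub>E\<^esub> t) \<in> G" if "(s, t) \<in> G" "r \<in> carrier R" for r s t
    using that G unfolding good_def by blast
  have Gz: "t = \<zero>\<^bsub>E\<^esub>" if "(\<zero>\<^bsub>N\<^esub>, t) \<in> G" for t using that G unfolding good_def by blast
  have Gf: "(f x, g x) \<in> G" if "x \<in> carrier M" for x using that G unfolding good_def by blast
  have G0: "(\<zero>\<^bsub>N\<^esub>, \<zero>\<^bsub>E\<^esub>) \<in> G" using Gf[of "\<zero>\<^bsub>M\<^esub>"] f0 by simp
  have Gn: "(\<ominus>\<^bsub>N\<^esub> s, \<ominus>\<^bsub>E\<^esub> t) \<in> G" if "(s, t) \<in> G" for s t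
    using Gs[OF that, of "\<ominus> \<one>"] Gc[OF that] by (simp add: N.smult_l_minus E.smult_l_minus)
  have Gu: "t = t'" if "(s, t) \<in> G" "(s, t') \<in> G" for s t t'
  proof -
    have "t \<oplus>\<^bsub>E\<^esub> \<ominus>\<^bsub>E\<^esub> t' = \<zero>\<^bsub>E\<^esub>"
      using Ga[OF that(1) Gn[OF that(2)]] Gc[OF that(1)] by (intro Gz) (simp add: N.M.r_neg)
    then show ?thesis
      using Gc[OF that(1)] Gc[OF that(2)] by (metis E.M.minus_equality E.M.minus_minus E.M.a_inv_closed)
  qed
  have total: "\<exists>t. (y, t) \<in> G" if y: "y \<in> carrier N" for y
  proof -
    define I where "I = {r \<in> carrier R. \<exists>t. (r \<odot>\<^bsub>N\<^esub> y, t) \<in> G}"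
    define \<phi> where "\<phi> r = (THE t. (r \<odot>\<^bsub>N\<^esub> y, t) \<in> G)" for r
    have phI: "\<phi> r = t" if "(r \<odot>\<^bsub>N\<^esub> y, t) \<in> G" for r t
      unfolding \<phi>_def using that Gu by blast
    have ph: "(r \<odot>\<^bsub>N\<^esub> y, \<phi> r) \<in> G" if "r \<in> I" for r using that phI by (auto simp: I_def)
    have add: "(r \<oplus> r') \<odot>\<^bsub>N\<^esub> y = r \<odot>\<^bsub>N\<^esub> y \<oplus>\<^bsub>N\<^esub> r' \<odot>\<^bsub>N\<^esub> y" if "r \<in> I" "r' \<in> I" for r r'
      using that y by (auto simp: I_def N.smult_l_distr)
    have sm: "(a \<otimes> r) \<odot>\<^bsub>N\<^esub> y = a \<odot>\<^bsub>N\<^esub> (r \<odot>\<^bsub>N\<^esub> y)" if "r \<in> I" "a \<in> carrier R" for r a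
      using that y by (auto simp: I_def N.smult_assoc1)
    have Iadd: "r \<oplus> r' \<in> I" "\<phi> (r \<oplus> r') = \<phi> r \<oplus>\<^bsub>E\<^esub> \<phi> r'" if "r \<in> I" "r' \<in> I" for r r'
    proof -
      have "((r \<oplus> r') \<odot>\<^bsub>N\<^esub> y, \<phi> r \<oplus>\<^bsub>E\<^esub> \<phi> r') \<in> G" using Ga ph that by (simp add: add)
      then show "r \<oplus> r' \<in> I" "\<phi> (r \<oplus> r') = \<phi> r \<oplus>\<^bsub>E\<^esub> \<phi> r'" using phI that by (auto simp: I_def)
    qed
    have Ism: "a \<otimes> r \<in> I" "\<phi> (a \<otimes> r) = a \<odot>\<^bsub>E\<^esub> \<phi> r" if "r \<in> I" "a \<in> carrier R" for r a
    proof -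
      have "((a \<otimes> r) \<odot>\<^bsub>N\<^esub> y, a \<odot>\<^bsub>E\<^esub> \<phi> r) \<in> G" using Gs ph that by (simp add: sm)
      then show "a \<otimes> r \<in> I" "\<phi> (a \<otimes> r) = a \<odot>\<^bsub>E\<^esub> \<phi> r" using phI that by (auto simp: I_def)
    qed
    have Isub: "I \<subseteq> carrier R" by (auto simp: I_def)
    have "ideal I R"
    proof (rule idealI)
      show "subgroup I (add_monoid R)"
      proof (rule E.R.add.subgroupI)
        show "I \<noteq> {}" using G0 y by (auto simp: I_def intro!: exI[of _ "\<zero>"])
        fix a assume a: "a \<in> I"
        then have "\<ominus> \<one> \<otimes> a \<in> I" by (intro Ism) auto
        then show "\<ominus> a \<in> I" using a Isub by (auto simp: E.R.l_minus)
      qed (use Isub Iadd in auto)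
    qed (use Ism Isub E.R.m_comm in \<open>auto simp: subset_eq intro: E.R.ring_axioms\<close>)
    moreover have "\<phi> \<in> I \<rightarrow> carrier E" using Gc ph by blast
    ultimately have "\<exists>e \<in> carrier E. \<forall>x \<in> I. \<phi> x = x \<odot>\<^bsub>E\<^esub> e"
      by (rule injective_module_Baer[OF inj]) (use Iadd Ism in auto)
    then obtain e where e: "e \<in> carrier E" "\<And>x. x \<in> I \<Longrightarrow> \<phi> x = x \<odot>\<^bsub>E\<^esub> e" by blast
    define G' where
      "G' = {(s \<oplus>\<^bsub>N\<^esub> r \<odot>\<^bsub>N\<^esub> y, t \<oplus>\<^bsub>E\<^esub> r \<odot>\<^bsub>E\<^esub> e) | s t r. (s, t) \<in> G \<and> r \<in> carrier R}"
    have GG': "(s, t) \<in> G'" if "(s, t) \<in> G" for s t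
    proof -
      have "(s, t) = (s \<oplus>\<^bsub>N\<^esub> \<zero> \<odot>\<^bsub>N\<^esub> y, t \<oplus>\<^bsub>E\<^esub> \<zero> \<odot>\<^bsub>E\<^esub> e)" using Gc[OF that] y e by simp
      then show ?thesis using that unfolding G'_def by blast
    qed
    have "good G'"
      unfolding good_def
    proof (intro conjI allI impI ballI)
      show "G' \<subseteq> carrier N \<times> carrier E" using Gc y e by (auto simp: G'_def)
    next
      fix s t s' t' assume "(s, t) \<in> G'" "(s', t') \<in> G'"
      then obtain u v r u' v' r' where *: "(u, v) \<in> G" "r \<in> carrier R" "(u', v') \<in> G" "r' \<in> carrier R"
        "s = u \<oplus>\<^bsub>N\<^esub> r \<odot>\<^bsub>N\<^esub> y" "t = v \<oplus>\<^bsub>E\<^esub> r \<odot>\<^bsub>E\<^esub> e"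
        "s' = u' \<oplus>\<^bsub>N\<^esub> r' \<odot>\<^bsub>N\<^esub> y" "t' = v' \<oplus>\<^bsub>E\<^esub> r' \<odot>\<^bsub>E\<^esub> e" by (auto simp: G'_def)
      have "s \<oplus>\<^bsub>N\<^esub> s' = (u \<oplus>\<^bsub>N\<^esub> u') \<oplus>\<^bsub>N\<^esub> (r \<oplus> r') \<odot>\<^bsub>N\<^esub> y"
        "t \<oplus>\<^bsub>E\<^esub> t' = (v \<oplus>\<^bsub>E\<^esub> v') \<oplus>\<^bsub>E\<^esub> (r \<oplus> r') \<odot>\<^bsub>E\<^esub> e"
        using * Gc[OF *(1)] Gc[OF *(3)] y e(1)
        by (simp_all add: N.smult_l_distr E.smult_l_distr N.M.a_ac E.M.a_ac)
      moreover have "(u \<oplus>\<^bsub>N\<^esub> u', v \<oplus>\<^bsub>E\<^esub> v') \<in> G" "r \<oplus> r' \<in> carrier R" using Ga * by auto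
      ultimately show "(s \<oplus>\<^bsub>N\<^esub> s', t \<oplus>\<^bsub>E\<^esub> t') \<in> G'" unfolding G'_def by blast
    next
      fix a s t assume a: "a \<in> carrier R" and "(s, t) \<in> G'"
      then obtain u v r where *: "(u, v) \<in> G" "r \<in> carrier R"
        "s = u \<oplus>\<^bsub>N\<^esub> r \<odot>\<^bsub>N\<^esub> y" "t = v \<oplus>\<^bsub>E\<^esub> r \<odot>\<^bsub>E\<^esub> e" by (auto simp: G'_def)
      have "a \<odot>\<^bsub>N\<^esub> s = a \<odot>\<^bsub>N\<^esub> u \<oplus>\<^bsub>N\<^esub> (a \<otimes> r) \<odot>\<^bsub>N\<^esub> y"
        "a \<odot>\<^bsub>E\<^esub> t = a \<odot>\<^bsub>E\<^esub> v \<oplus>\<^bsub>E\<^esub> (a \<otimes> r) \<odot>\<^bsub>E\<^esub> e"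
        using * a Gc[OF *(1)] y e(1)
        by (simp_all add: N.smult_r_distr E.smult_r_distr N.smult_assoc1 E.smult_assoc1)
      moreover have "(a \<odot>\<^bsub>N\<^esub> u, a \<odot>\<^bsub>E\<^esub> v) \<in> G" "a \<otimes> r \<in> carrier R" using Gs * a by auto
      ultimately show "(a \<odot>\<^bsub>N\<^esub> s, a \<odot>\<^bsub>E\<^esub> t) \<in> G'" unfolding G'_def by blast
    next
      fix t assume "(\<zero>\<^bsub>N\<^esub>, t) \<in> G'"
      then obtain u v r where *: "(u, v) \<in> G" "r \<in> carrier R"
        "\<zero>\<^bsub>N\<^esub> = u \<oplus>\<^bsub>N\<^esub> r \<odot>\<^bsub>N\<^esub> y" "t = v \<oplus>\<^bsub>E\<^esub> r \<odot>\<^bsub>E\<^esub> e" by (auto simp: G'_def)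
      have "r \<odot>\<^bsub>N\<^esub> y = \<ominus>\<^bsub>N\<^esub> u"
        using *(2,3) Gc[OF *(1)] y by (metis N.M.a_comm N.M.minus_equality N.smult_closed)
      then have "(r \<odot>\<^bsub>N\<^esub> y, \<ominus>\<^bsub>E\<^esub> v) \<in> G" using Gn[OF *(1)] by simp
      then have "r \<in> I" "\<phi> r = \<ominus>\<^bsub>E\<^esub> v" using *(2) phI by (auto simp: I_def)
      then have "r \<odot>\<^bsub>E\<^esub> e = \<ominus>\<^bsub>E\<^esub> v" using e(2) by simp
      then show "t = \<zero>\<^bsub>E\<^esub>" using *(4) Gc[OF *(1)] by (simp add: E.M.r_neg)
    next
      fix x assume "x \<in> carrier M" then show "(f x, g x) \<in> G'" using Gf GG' by blast
    qed
    then have "G' = G" using GG' by (intro max) auto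
    moreover have "(\<zero>\<^bsub>N\<^esub> \<oplus>\<^bsub>N\<^esub> \<one> \<odot>\<^bsub>N\<^esub> y, \<zero>\<^bsub>E\<^esub> \<oplus>\<^bsub>E\<^esub> \<one> \<odot>\<^bsub>E\<^esub> e) \<in> G'"
      using G0 unfolding G'_def by blast
    ultimately show ?thesis using y by auto
  qed
  define h where "h y = (THE t. (y, t) \<in> G)" for y
  have hI: "h y = t" if "(y, t) \<in> G" for y t
    unfolding h_def using that Gu by blast
  have hG: "(y, h y) \<in> G" if "y \<in> carrier N" for y using total[OF that] hI by auto
  have "h \<in> mod_hom R N E"
    unfolding mod_hom_def using Gc(2)[OF hG] Ga Gs hG hI by auto
  moreover have "\<forall>x \<in> carrier M. h (f x) = g x" using Gf hI by blast
  ultimately show "\<exists>h \<in> mod_hom R N E. \<forall>x \<in> carrier M. h (f x) = g x" by blast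
qed

end

theory Submission
  imports Defs
begin

text \<open>Two facts together give the result. For every ideal \<open>I\<close>, the integral hull of \<open>0 :\<^sub>E I\<close> is
\<open>0 :\<^sub>E core(I)\<close>; and for all ideals \<open>K\<close> and \<open>L\<close>, \<open>0 :\<^sub>E (K : L) = L (0 :\<^sub>E K)\<close>. The assumption
that the core is a colon ideal lets the second fact rewrite the first.

The second fact (\<open>mod_ann_colon\<close>) holds over any Noetherian ring, because \<open>E\<close> is injective. If \<open>L\<close> is
generated by \<open>b\<^sub>1, \<dots>, b\<^sub>r\<close>, then \<open>K : L\<close> is the intersection of the ideals \<open>K : b\<^sub>i\<close>. By Baer's
criterion, an element killed by \<open>A \<inter> B\<close> is a sum of one killed by \<open>A\<close> and one killed by \<open>B\<close>, and an
element killed by \<open>K : b\<close> has the form \<open>b f\<close> with \<open>K f = 0\<close>. Both are instances of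
\<open>solve_in_injective\<close>.

For the first fact (\<open>integral_hull_eq_core_annihilator\<close>), let \<open>C\<close> be one of the submodules whose sum
is the hull, and let \<open>K\<close> be its annihilator in \<open>R\<close>. Ideals are recovered from their annihilators in
\<open>E\<close> (\<open>ring_ann_mod_ann\<close>), so \<open>K\<close> lies in \<open>I\<close> and has the same integral closure, hence is a reduction
of \<open>I\<close>. Conversely the annihilator of a reduction is such a submodule. So the hull is the sum of the
\<open>0 :\<^sub>E K\<close> over all reductions \<open>K\<close>. This sum clearly lies in \<open>0 :\<^sub>E core(I)\<close>. Equality is a statement
about an infinite intersection, and here completeness enters: an element of \<open>E\<close> is killed by a power
of \<open>\<mm>\<close>, and by Chevalley's theorem some member of a directed family of ideals is contained in the
intersection up to that power. Therefore, if an element of \<open>E\<close> is killed by the intersection of a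
directed family, it is killed by a member (\<open>annihilated_by_directed_Inter\<close>). The family used consists
of all ideals whose annihilator in \<open>E\<close> lies in the hull; it contains the reductions, and it is closed
under intersection by the decomposition above.

The equivalence of reductions and equal integral closures rests on two observations. An element \<open>x\<close>
is integral over \<open>K\<close> if and only if \<open>K\<close> is a reduction of \<open>K + (x)\<close>; and if \<open>K\<close> is a reduction of
\<open>M\<close>, every element of \<open>M\<close> is integral over \<open>K\<close>. The second is the determinant trick, carried out by
eliminating generators one at a time (\<open>monic_relation_for_generators\<close>).\<close>

no_notation Sum_Type.Plus (infixr \<open><+>\<close> 65)

section \<open>Ideal arithmetic\<close>

context cring
begin

lemma ideal_closed:
  assumes "ideal I R"
  shows "\<zero> \<in> I"
    and "x \<in> I \<Longrightarrow> y \<in> I \<Longrightarrow> x \<oplus> y \<in> I"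
    and "x \<in> I \<Longrightarrow> \<ominus> x \<in> I"
    and "x \<in> I \<Longrightarrow> y \<in> I \<Longrightarrow> x \<ominus> y \<in> I"
    and "r \<in> carrier R \<Longrightarrow> x \<in> I \<Longrightarrow> r \<otimes> x \<in> I"
    and "r \<in> carrier R \<Longrightarrow> x \<in> I \<Longrightarrow> x \<otimes> r \<in> I"
    and "x \<in> I \<Longrightarrow> x \<in> carrier R"
proof -
  interpret ideal I R by fact
  show "\<zero> \<in> I" "x \<in> I \<Longrightarrow> y \<in> I \<Longrightarrow> x \<oplus> y \<in> I" "x \<in> I \<Longrightarrow> \<ominus> x \<in> I"
    "x \<in> I \<Longrightarrow> y \<in> I \<Longrightarrow> x \<ominus> y \<in> I"
    "r \<in> carrier R \<Longrightarrow> x \<in> I \<Longrightarrow> r \<otimes> x \<in> I"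
    "r \<in> carrier R \<Longrightarrow> x \<in> I \<Longrightarrow> x \<otimes> r \<in> I"
    "x \<in> I \<Longrightarrow> x \<in> carrier R"
    using I_l_closed I_r_closed Icarr by (auto simp: a_minus_def)
qed

lemma ideal_criterion:
  assumes "I \<subseteq> carrier R" "\<zero> \<in> I"
    and add: "\<And>x y. x \<in> I \<Longrightarrow> y \<in> I \<Longrightarrow> x \<oplus> y \<in> I"
    and mult: "\<And>r x. r \<in> carrier R \<Longrightarrow> x \<in> I \<Longrightarrow> r \<otimes> x \<in> I"
  shows "ideal I R"
proof (rule idealI[OF ring_axioms])
  show "subgroup I (add_monoid R)"
  proof (rule add.subgroupI)
    fix a assume a: "a \<in> I"
    then have "\<ominus> \<one> \<otimes> a \<in> I" by (intro mult) auto
    then show "\<ominus> a \<in> I" using a assms(1) by (auto simp: l_minus)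
  qed (use assms in auto)
  fix a r assume "a \<in> I" "r \<in> carrier R"
  then show "r \<otimes> a \<in> I" "a \<otimes> r \<in> I" using mult m_comm[of a r] assms(1) by auto
qed

lemma quotient_by_element_ideal:
  assumes "ideal Q R" "x \<in> carrier R"
  shows "ideal {r \<in> carrier R. r \<otimes> x \<in> Q} R"
  using assms ideal_closed[OF assms(1)]
  by (intro ideal_criterion) (auto simp: l_distr m_assoc)

lemma Idl_mult_in_ideal:
  assumes "ideal Q R" "x \<in> carrier R" "B \<subseteq> carrier R" "\<And>b. b \<in> B \<Longrightarrow> x \<otimes> b \<in> Q"
    and y: "y \<in> Idl B"
  shows "x \<otimes> y \<in> Q"
proof -
  have "B \<subseteq> {r \<in> carrier R. r \<otimes> x \<in> Q}"
  proof (intro subsetI CollectI conjI)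
    fix b assume b: "b \<in> B"
    then show c: "b \<in> carrier R" using assms(3) by blast
    show "b \<otimes> x \<in> Q" using assms(4)[OF b] by (simp only: m_comm[OF c assms(2)])
  qed
  then have "Idl B \<subseteq> {r \<in> carrier R. r \<otimes> x \<in> Q}"
    by (intro genideal_minimal quotient_by_element_ideal assms)
  then have "y \<in> carrier R" "y \<otimes> x \<in> Q" using y by blast+
  then show ?thesis by (simp only: m_comm[OF assms(2)])
qed

lemma ideal_prod_subset:
  assumes "ideal L R" "\<And>a b. a \<in> A \<Longrightarrow> b \<in> B \<Longrightarrow> a \<otimes> b \<in> L"
  shows "A \<cdot> B \<subseteq> L"
proof
  fix s assume "s \<in> A \<cdot> B"
  then show "s \<in> L"
    by (induct rule: ideal_prod.induct) (use assms ideal_closed in auto)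
qed

lemma ideal_prod_mono:
  assumes "A \<subseteq> A'" "B \<subseteq> B'"
  shows "A \<cdot> B \<subseteq> A' \<cdot> B'"
proof
  fix s assume "s \<in> A \<cdot> B"
  then show "s \<in> A' \<cdot> B'"
    by (induct rule: ideal_prod.induct) (use assms in \<open>auto intro: ideal_prod.intros\<close>)
qed

lemma mem_sum_ideals: "x \<in> A <+> B \<longleftrightarrow> (\<exists>a\<in>A. \<exists>b\<in>B. x = a \<oplus> b)"
  by (auto simp: set_add_def')

lemma sum_ideals_upper:
  assumes "ideal A R" "ideal B R"
  shows "A \<subseteq> A <+> B" "B \<subseteq> A <+> B"
proof -
  show "A \<subseteq> A <+> B"
  proof
    fix a assume "a \<in> A"
    then show "a \<in> A <+> B"
      using ideal_closed(7)[OF assms(1)] ideal_closed(1)[OF assms(2)]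
      unfolding mem_sum_ideals by (intro bexI[of _ a] bexI[of _ \<zero>]) auto
  qed
  show "B \<subseteq> A <+> B"
  proof
    fix a assume "a \<in> B"
    then show "a \<in> A <+> B"
      using ideal_closed(1)[OF assms(1)] ideal_closed(7)[OF assms(2)]
      unfolding mem_sum_ideals by (intro bexI[of _ \<zero>] bexI[of _ a]) auto
  qed
qed

lemma sum_ideals_least:
  assumes "ideal C R" "A \<subseteq> C" "B \<subseteq> C"
  shows "A <+> B \<subseteq> C"
  using assms(2,3) by (auto simp: mem_sum_ideals intro!: ideal_closed(2)[OF assms(1)])

lemma sum_ideals_comm:
  assumes "ideal A R" "ideal B R"
  shows "A <+> B = B <+> A"
  by (metis assms sup_commute union_genideal)

lemma sum_ideals_absorb:
  assumes "ideal A R" "ideal B R" "A \<subseteq> B"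
  shows "A <+> B = B"
  using sum_ideals_least[OF assms(2,3)] sum_ideals_upper[OF assms(1,2)] by auto

text \<open>Powers of ideals are powers in the monoid of ideals. These rules let the generic rules for
powers in a monoid compute with the ideal product.\<close>

lemma ideals_set_simps [simp]:
  "\<one>\<^bsub>ideals_set R\<^esub> = carrier R" "A \<otimes>\<^bsub>ideals_set R\<^esub> B = A \<cdot> B"
  by (simp_all add: ideals_set_def)

lemma ideal_pow_Suc: "ideal_pow R K (Suc n) = ideal_pow R K n \<cdot> K"
  by simp

lemma ideal_pow_ideal:
  assumes "ideal K R" shows "ideal (ideal_pow R K n) R"
  by (induct n) (use assms in \<open>auto intro: oneideal ideal_prod_is_ideal\<close>)

lemma ideal_one_prod: "ideal A R \<Longrightarrow> carrier R \<cdot> A = A"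
  by (simp add: ideal_prod_commute[OF oneideal] ideal_prod_one)

lemma ideal_pow_1: "ideal K R \<Longrightarrow> ideal_pow R K (Suc 0) = K"
  by (simp add: ideal_one_prod)

lemma ideal_pow_add:
  assumes "ideal K R"
  shows "ideal_pow R K m \<cdot> ideal_pow R K n = ideal_pow R K (m + n)"
proof (induct n)
  case (Suc n)
  then show ?case
    using ideal_prod_assoc[OF ideal_pow_ideal[OF assms] ideal_pow_ideal[OF assms] assms, of m n]
    by simp
qed (simp add: ideal_prod_one ideal_pow_ideal assms)

lemma ideal_prod_left_commute:
  assumes "ideal A R" "ideal B R" "ideal C R"
  shows "A \<cdot> (B \<cdot> C) = B \<cdot> (A \<cdot> C)"
  by (simp add: ideal_prod_assoc[symmetric] ideal_prod_commute[OF assms(1,2)] assms)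

lemma ideal_pow_mono:
  assumes "K \<subseteq> L" shows "ideal_pow R K n \<subseteq> ideal_pow R L n"
  by (induct n) (use assms ideal_prod_mono in auto)

lemma ideal_pow_antimono:
  assumes "ideal K R" "m \<le> n"
  shows "ideal_pow R K n \<subseteq> ideal_pow R K m"
proof -
  have "ideal_pow R K n = ideal_pow R K m \<cdot> ideal_pow R K (n - m)"
    using assms by (simp add: ideal_pow_add)
  then show ?thesis
    using ideal_prod_inter[OF ideal_pow_ideal ideal_pow_ideal, OF assms(1) assms(1)] by auto
qed

lemma pow_in_ideal_pow:
  assumes "ideal K R" "x \<in> K" shows "x [^] (n::nat) \<in> ideal_pow R K n"
  using assms ideal_closed(7)[OF assms]
  by (induct n) (auto intro: ideal_prod.prod)

lemma cgenideal_pow: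
  assumes x: "x \<in> carrier R"
  shows "ideal_pow R (PIdl x) n \<subseteq> PIdl (x [^] n)"
proof (induct n)
  case 0
  then show ?case by (force simp: cgenideal_def)
next
  case (Suc n)
  have "a \<otimes> b \<in> PIdl (x [^] Suc n)" if a: "a \<in> ideal_pow R (PIdl x) n" and b: "b \<in> PIdl x" for a b
  proof -
    obtain r s where "r \<in> carrier R" "s \<in> carrier R" "a = r \<otimes> x [^] n" "b = s \<otimes> x"
      using Suc a b by (auto simp: cgenideal_def)
    moreover from this have "a \<otimes> b = (r \<otimes> s) \<otimes> (x [^] n \<otimes> x)" using x by (simp add: m_ac)
    ultimately show ?thesis by (auto simp: cgenideal_def)
  qed
  then show ?case
    unfolding ideal_pow_Suc using x by (intro ideal_prod_subset cgenideal_ideal nat_pow_closed)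
qed

text \<open>In the expansion of \<open>(A + B)\<^sup>s\<^sup>+\<^sup>1\<close> every term except \<open>A\<^sup>s\<^sup>+\<^sup>1\<close> has a factor \<open>B\<close>. This is the
only expansion of a power of a sum of ideals that the theory of reductions requires.\<close>

lemma pow_sum_subset:
  assumes "ideal A R" "ideal B R"
  shows "ideal_pow R (A <+> B) (Suc s) \<subseteq> ideal_pow R A (Suc s) <+> B \<cdot> ideal_pow R (A <+> B) s"
proof (induct s)
  case 0
  show ?case using assms by (simp add: ideal_pow_1 ideal_prod_one add_ideals ideal_one_prod)
next
  case (Suc s)
  let ?L = "A <+> B"
  note L = add_ideals[OF assms]
  note ids = assms L ideal_pow_ideal[OF assms(1)] ideal_pow_ideal[OF L]
  let ?C = "ideal_pow R A (Suc (Suc s)) <+> B \<cdot> ideal_pow R ?L (Suc s)"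
  have C: "ideal ?C R" by (intro add_ideals ideal_prod_is_ideal ids)
  have up: "ideal_pow R A (Suc (Suc s)) \<subseteq> ?C" "B \<cdot> ideal_pow R ?L (Suc s) \<subseteq> ?C"
    by (intro sum_ideals_upper ideal_prod_is_ideal ids)+
  have "ideal_pow R A (Suc s) \<cdot> B \<subseteq> B \<cdot> ideal_pow R ?L (Suc s)"
    using ideal_prod_mono[OF order_refl ideal_pow_mono[OF sum_ideals_upper(1)[OF assms]], of B "Suc s"]
    by (simp only: ideal_prod_commute[OF ids(4) ids(2)])
  moreover have "B \<cdot> ideal_pow R ?L s \<cdot> ?L = B \<cdot> ideal_pow R ?L (Suc s)"
    using ideal_prod_assoc[OF ids(2) ids(5) ids(3)] by simp
  ultimately have *: "a \<otimes> l \<in> ?C"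
    if a: "a \<in> ideal_pow R A (Suc s) \<union> B \<cdot> ideal_pow R ?L s" and l: "l \<in> ?L" for a l
  proof -
    have ac: "a \<in> carrier R"
      using a ideal_closed(7)[OF ids(4)] ideal_closed(7)[OF ideal_prod_is_ideal[OF ids(2) ids(5)]]
      by blast
    obtain p q where pq: "p \<in> A" "q \<in> B" "l = p \<oplus> q" using l by (auto simp: mem_sum_ideals)
    show ?thesis
    proof (cases "a \<in> ideal_pow R A (Suc s)")
      case True
      have "a \<otimes> l = a \<otimes> p \<oplus> a \<otimes> q"
        using ac pq ideal_closed(7) assms by (simp add: r_distr)
      moreover have "a \<otimes> p \<in> ?C"
        using up(1) ideal_prod.prod[OF True pq(1)] by auto
      moreover have "a \<otimes> q \<in> ?C"
        using up(2) ideal_prod.prod[OF True pq(2)]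
          \<open>ideal_pow R A (Suc s) \<cdot> B \<subseteq> B \<cdot> ideal_pow R ?L (Suc s)\<close> by blast
      ultimately show ?thesis using ideal_closed(2)[OF C] by simp
    next
      case False
      then have "a \<otimes> l \<in> B \<cdot> ideal_pow R ?L s \<cdot> ?L" using a l by (auto intro: ideal_prod.prod)
      then show ?thesis
        using up(2) \<open>B \<cdot> ideal_pow R ?L s \<cdot> ?L = B \<cdot> ideal_pow R ?L (Suc s)\<close> by blast
    qed
  qed
  have "ideal_pow R ?L (Suc s) \<cdot> ?L \<subseteq> ?C"
  proof (rule ideal_prod_subset[OF C])
    fix a l assume "a \<in> ideal_pow R ?L (Suc s)" and l: "l \<in> ?L"
    then obtain b c where bc: "b \<in> ideal_pow R A (Suc s)" "c \<in> B \<cdot> ideal_pow R ?L s" "a = b \<oplus> c"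
      using subsetD[OF Suc] unfolding mem_sum_ideals by blast
    have "a \<otimes> l = b \<otimes> l \<oplus> c \<otimes> l"
      unfolding bc(3)
      by (intro l_distr ideal_closed(7)[OF ids(4) bc(1)] ideal_closed(7)[OF L l]
          ideal_closed(7)[OF ideal_prod_is_ideal[OF ids(2) ids(5)] bc(2)])
    then show "a \<otimes> l \<in> ?C" using * bc l ideal_closed(2)[OF C] by auto
  qed
  then show ?case by simp
qed

end

section \<open>Reductions\<close>

context cring
begin

lemma reductionI:
  assumes "ideal K R" "ideal L R" "K \<subseteq> L" "ideal_pow R L (Suc s) \<subseteq> K \<cdot> ideal_pow R L s"
  shows "reduction R K L"
proof -
  have "K \<cdot> ideal_pow R L s \<subseteq> ideal_pow R L (Suc s)"
    using ideal_prod_mono[OF assms(3) order_refl, of "ideal_pow R L s"]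
    by (simp add: ideal_prod_commute[OF ideal_pow_ideal[OF assms(2)] assms(2)])
  then show ?thesis using assms unfolding reduction_def by auto
qed

lemma reduction_refl: "ideal K R \<Longrightarrow> reduction R K K"
  by (rule reductionI[of _ _ 0]) (simp_all add: ideal_one_prod ideal_prod_one)

text \<open>If \<open>L\<^sup>s\<^sup>+\<^sup>1 = K L\<^sup>s\<close> and \<open>M\<^sup>t\<^sup>+\<^sup>1 = L M\<^sup>t\<close>, then
\<open>M\<^sup>s\<^sup>+\<^sup>t\<^sup>+\<^sup>1 = L\<^sup>s\<^sup>+\<^sup>1 M\<^sup>t = K L\<^sup>s M\<^sup>t = K M\<^sup>s\<^sup>+\<^sup>t\<close>.\<close>

lemma reduction_trans:
  assumes "reduction R K L" "reduction R L M" "ideal L R" "ideal M R"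
  shows "reduction R K M"
proof -
  obtain s where s: "ideal_pow R L (Suc s) = K \<cdot> ideal_pow R L s" and K: "ideal K R" "K \<subseteq> L"
    using assms(1) by (auto simp: reduction_def)
  obtain t where t: "ideal_pow R M (Suc t) = L \<cdot> ideal_pow R M t" and "L \<subseteq> M"
    using assms(2) by (auto simp: reduction_def)
  note pow = ideal_pow_ideal[OF assms(3)] ideal_pow_ideal[OF assms(4)]
  have iter: "ideal_pow R M (i + t) = ideal_pow R L i \<cdot> ideal_pow R M t" for i
  proof (induct i)
    case 0
    then show ?case using pow by (simp add: ideal_one_prod)
  next
    case (Suc i)
    have "ideal_pow R M (Suc i + t) = M \<cdot> (ideal_pow R L i \<cdot> ideal_pow R M t)"
      using Suc by (simp add: ideal_prod_commute[OF _ assms(4)] ideal_prod_is_ideal pow)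
    also have "\<dots> = ideal_pow R L i \<cdot> (ideal_pow R M t \<cdot> M)"
      by (simp only: ideal_prod_left_commute[OF assms(4) pow] ideal_prod_commute[OF assms(4) pow(2)])
    also have "\<dots> = (ideal_pow R L i \<cdot> L) \<cdot> ideal_pow R M t"
      using t ideal_prod_assoc[OF pow(1) assms(3) pow(2)] by simp
    finally show ?case by simp
  qed
  have "ideal_pow R M (Suc (s + t)) = K \<cdot> ideal_pow R L s \<cdot> ideal_pow R M t"
    using iter[of "Suc s"] s by simp
  also have "\<dots> = K \<cdot> ideal_pow R M (s + t)"
    using iter[of s] ideal_prod_assoc[OF K(1) pow(1) pow(2)] by simp
  finally show ?thesis using K \<open>L \<subseteq> M\<close> by (intro reductionI[where s="s + t"]) (use assms in auto)
qed

text \<open>By \<open>pow_sum_subset\<close>, \<open>(L + N)\<^sup>s\<^sup>+\<^sup>1\<close> is contained in \<open>L\<^sup>s\<^sup>+\<^sup>1 + N (L + N)\<^sup>s\<close>, and the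
first summand is \<open>K L\<^sup>s\<close>.\<close>

lemma reduction_add:
  assumes "reduction R K L" "ideal L R" "ideal N R"
  shows "reduction R (K <+> N) (L <+> N)"
proof -
  obtain s where s: "ideal_pow R L (Suc s) = K \<cdot> ideal_pow R L s" and K: "ideal K R" "K \<subseteq> L"
    using assms(1) by (auto simp: reduction_def)
  note KN = add_ideals[OF K(1) assms(3)] and LN = add_ideals[OF assms(2,3)]
  let ?P = "ideal_pow R (L <+> N) s"
  have P: "ideal ?P R" by (rule ideal_pow_ideal[OF LN])
  have tgt: "ideal ((K <+> N) \<cdot> ?P) R" by (rule ideal_prod_is_ideal[OF KN P])
  have "K \<cdot> ideal_pow R L s \<subseteq> (K <+> N) \<cdot> ?P"
    by (intro ideal_prod_mono ideal_pow_mono sum_ideals_upper K assms)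
  moreover have "N \<cdot> ?P \<subseteq> (K <+> N) \<cdot> ?P"
    by (intro ideal_prod_mono sum_ideals_upper K assms order_refl)
  ultimately have "ideal_pow R (L <+> N) (Suc s) \<subseteq> (K <+> N) \<cdot> ?P"
    using subset_trans[OF pow_sum_subset[OF assms(2,3), of s] sum_ideals_least[OF tgt]] s by simp
  moreover have "K <+> N \<subseteq> L <+> N"
    by (rule sum_ideals_least[OF LN])
      (use sum_ideals_upper[OF assms(2,3)] K in auto)
  ultimately show ?thesis by (intro reductionI[OF KN LN])
qed

end

section \<open>Integral closure by means of reductions\<close>

context cring
begin

text \<open>The ideal \<open>K (K + (x))\<^sup>m\<close> consists of the possible lower order parts of an equation of
integral dependence of degree \<open>m + 1\<close>. The coefficients are split off one at a time: by
\<open>pow_sum_subset\<close>, \<open>K (K + (x))\<^sup>m\<^sup>+\<^sup>1\<close> lies in \<open>K\<^sup>m\<^sup>+\<^sup>2 + x K (K + (x))\<^sup>m\<close>.\<close>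

lemma prod_adjoin_expand:
  assumes K: "ideal K R" and x: "x \<in> carrier R"
    and v: "v \<in> K \<cdot> ideal_pow R (K <+> PIdl x) m"
  shows "\<exists>a. (\<forall>i\<in>{1..Suc m}. a i \<in> ideal_pow R K i) \<and>
     v = (\<Oplus>i\<in>{1..Suc m}. a i \<otimes> x [^] (Suc m - i))"
  using v
proof (induct m arbitrary: v)
  case 0
  then have "v \<in> K" by (simp add: ideal_prod_one K)
  then show ?case
    using ideal_closed(7)[OF K] by (intro exI[of _ "\<lambda>_. v"]) (simp add: ideal_one_prod K)
next
  case (Suc m)
  let ?X = "PIdl x" let ?L = "K <+> PIdl x"
  note X = cgenideal_ideal[OF x]
  note L = add_ideals[OF K X]
  note Km = ideal_pow_ideal[OF K] and Lm = ideal_pow_ideal[OF L]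
  have "K \<cdot> ideal_pow R ?L (Suc m) \<subseteq> K \<cdot> (ideal_pow R K (Suc m) <+> ?X \<cdot> ideal_pow R ?L m)"
    by (intro ideal_prod_mono order_refl pow_sum_subset K X)
  also have "\<dots> = K \<cdot> ideal_pow R K (Suc m) <+> K \<cdot> (?X \<cdot> ideal_pow R ?L m)"
    by (intro ideal_prod_r_distr K Km ideal_prod_is_ideal X Lm)
  also have "K \<cdot> ideal_pow R K (Suc m) = ideal_pow R K (Suc (Suc m))"
    by (simp only: ideal_pow_Suc[of K "Suc m"] ideal_prod_commute[OF K Km])
  also have "K \<cdot> (?X \<cdot> ideal_pow R ?L m) = ?X \<cdot> (K \<cdot> ideal_pow R ?L m)"
    by (rule ideal_prod_left_commute[OF K X Lm])
  finally have "v \<in> ideal_pow R K (Suc (Suc m)) <+> ?X \<cdot> (K \<cdot> ideal_pow R ?L m)"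
    using Suc.prems by (rule subsetD)
  then obtain p q where pq: "p \<in> ideal_pow R K (Suc (Suc m))"
    "q \<in> ?X \<cdot> (K \<cdot> ideal_pow R ?L m)" "v = p \<oplus> q"
    unfolding mem_sum_ideals by blast
  note V = ideal_prod_is_ideal[OF K Lm[of m]]
  have "\<exists>w \<in> K \<cdot> ideal_pow R ?L m. q = w \<otimes> x"
    using pq(2)
  proof (induct q rule: ideal_prod.induct)
    case (prod i j)
    then obtain r where r: "r \<in> carrier R" "i = r \<otimes> x" by (auto simp: cgenideal_def)
    have "i \<otimes> j = (r \<otimes> j) \<otimes> x" using r x ideal_closed(7)[OF V prod(2)] by (simp add: m_ac)
    then show ?case using ideal_closed(5)[OF V r(1) prod(2)] by blast
  next
    case (sum s1 s2)
    then obtain w1 w2 where "w1 \<in> K \<cdot> ideal_pow R ?L m" "s1 = w1 \<otimes> x"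
      "w2 \<in> K \<cdot> ideal_pow R ?L m" "s2 = w2 \<otimes> x" by blast
    then show ?case using ideal_closed(2,7)[OF V] x
      by (intro bexI[of _ "w1 \<oplus> w2"]) (auto simp: l_distr)
  qed
  then obtain w where w: "w \<in> K \<cdot> ideal_pow R ?L m" "q = w \<otimes> x" by blast
  obtain a where a: "\<forall>i\<in>{1..Suc m}. a i \<in> ideal_pow R K i"
    "w = (\<Oplus>i\<in>{1..Suc m}. a i \<otimes> x [^] (Suc m - i))"
    using Suc.hyps[OF w(1)] by blast
  have ac: "a i \<in> carrier R" if "i \<in> {1..Suc m}" for i
    using a(1) that ideal_closed(7)[OF Km] by blast
  \<comment> \<open>the new constant coefficient is \<open>p\<close>; the others are those of \<open>w\<close>, whose powers of \<open>x\<close> increase by one\<close>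
  define b where "b = a(Suc (Suc m) := p)"
  have pc: "p \<in> carrier R" using pq(1) ideal_closed(7)[OF Km] by blast
  have "q = (\<Oplus>i\<in>{1..Suc m}. a i \<otimes> x [^] (Suc m - i) \<otimes> x)"
    unfolding w(2) a(2) by (rule finsum_ldistr) (use x ac in auto)
  also have "\<dots> = (\<Oplus>i\<in>{1..Suc m}. b i \<otimes> x [^] (Suc (Suc m) - i))"
  proof (rule finsum_cong')
    show "(\<lambda>i. b i \<otimes> x [^] (Suc (Suc m) - i)) \<in> {1..Suc m} \<rightarrow> carrier R"
      using ac x by (auto simp: b_def)
    fix i assume i: "i \<in> {1..Suc m}"
    then have "Suc (Suc m) - i = Suc (Suc m - i)" by auto
    then show "a i \<otimes> x [^] (Suc m - i) \<otimes> x = b i \<otimes> x [^] (Suc (Suc m) - i)"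
      using ac[OF i] x i by (simp add: b_def m_assoc)
  qed simp
  finally have q: "q = (\<Oplus>i\<in>{1..Suc m}. b i \<otimes> x [^] (Suc (Suc m) - i))" .
  have "(\<Oplus>i\<in>insert (Suc (Suc m)) {1..Suc m}. b i \<otimes> x [^] (Suc (Suc m) - i)) = p \<oplus> q"
    unfolding q using ac x pc by (subst finsum_insert) (auto simp: b_def)
  moreover have "{1..Suc (Suc m)} = insert (Suc (Suc m)) {1..Suc m}" by auto
  ultimately have "v = (\<Oplus>i\<in>{1..Suc (Suc m)}. b i \<otimes> x [^] (Suc (Suc m) - i))"
    using pq(3) by simp
  moreover have "\<forall>i\<in>{1..Suc (Suc m)}. b i \<in> ideal_pow R K i"
    using a(1) pq(1) by (auto simp: b_def simp del: Group.nat_pow_Suc)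
  ultimately show ?case by blast
qed

lemma finsum_in_ideal:
  assumes "ideal I R" "finite A" "\<And>i. i \<in> A \<Longrightarrow> f i \<in> I"
  shows "finsum R f A \<in> I"
  using assms(2,3)
proof (induct A)
  case (insert a A)
  then show ?case
    using ideal_closed(2,7)[OF assms(1)] by (subst finsum_insert) auto
qed (use ideal_closed(1)[OF assms(1)] in simp)

text \<open>This replaces the equation of integral dependence by a membership in a product of ideals,
after which coefficients never have to be mentioned again.\<close>

lemma integral_closure_iff:
  assumes K: "ideal K R"
  shows "x \<in> integral_closure R K \<longleftrightarrow>
    x \<in> carrier R \<and> (\<exists>m. x [^] Suc m \<in> K \<cdot> ideal_pow R (K <+> PIdl x) m)"
proof (cases "x \<in> carrier R")
  case x: True
  let ?L = "K <+> PIdl x"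
  note X = cgenideal_ideal[OF x]
  note L = add_ideals[OF K X]
  note Km = ideal_pow_ideal[OF K] and Lm = ideal_pow_ideal[OF L]
  have xL: "x \<in> ?L" using sum_ideals_upper(2)[OF K X] cgenideal_self[OF x] by blast
  show ?thesis
  proof
    assume "x \<in> integral_closure R K"
    then obtain n a where n: "n \<ge> 1" and a: "\<forall>i\<in>{1..n}. a i \<in> ideal_pow R K i"
      and eq: "x [^] n \<oplus> (\<Oplus>i\<in>{1..n}. a i \<otimes> x [^] (n - i)) = \<zero>"
      unfolding integral_closure_def by blast
    obtain m where m: "n = Suc m" using n by (cases n) auto
    note V = ideal_prod_is_ideal[OF K Lm[of m]]
    have "a i \<otimes> x [^] (n - i) \<in> K \<cdot> ideal_pow R ?L m" if i: "i \<in> {1..n}" for i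
    proof -
      obtain j where j: "i = Suc j" using i by (cases i) auto
      have "ideal_pow R K i \<subseteq> K \<cdot> ideal_pow R ?L j"
        unfolding j ideal_pow_Suc ideal_prod_commute[OF Km K]
        by (intro ideal_prod_mono order_refl ideal_pow_mono sum_ideals_upper K X)
      then have "a i \<otimes> x [^] (m - j) \<in> (K \<cdot> ideal_pow R ?L j) \<cdot> ideal_pow R ?L (m - j)"
        using a i pow_in_ideal_pow[OF L xL] by (intro ideal_prod.prod) auto
      also have "\<dots> = K \<cdot> ideal_pow R ?L m"
        using i m j by (simp add: ideal_prod_assoc[OF K Lm Lm] ideal_pow_add[OF L])
      finally show ?thesis using m j by simp
    qed
    then have S: "(\<Oplus>i\<in>{1..n}. a i \<otimes> x [^] (n - i)) \<in> K \<cdot> ideal_pow R ?L m"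
      by (intro finsum_in_ideal[OF V]) auto
    have "x [^] n = \<ominus> (\<Oplus>i\<in>{1..n}. a i \<otimes> x [^] (n - i))"
      using minus_equality[OF eq] ideal_closed(7)[OF V S] x by (metis minus_equality a_comm eq nat_pow_closed)
    then show "x \<in> carrier R \<and> (\<exists>m. x [^] Suc m \<in> K \<cdot> ideal_pow R ?L m)"
      using ideal_closed(3)[OF V S] m x by metis
  next
    assume "x \<in> carrier R \<and> (\<exists>m. x [^] Suc m \<in> K \<cdot> ideal_pow R ?L m)"
    then obtain m where m: "x [^] Suc m \<in> K \<cdot> ideal_pow R ?L m" by blast
    then have "\<ominus> (x [^] Suc m) \<in> K \<cdot> ideal_pow R ?L m"
      by (rule ideal_closed(3)[OF ideal_prod_is_ideal[OF K Lm]])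
    then obtain a where a: "\<forall>i\<in>{1..Suc m}. a i \<in> ideal_pow R K i"
      "\<ominus> (x [^] Suc m) = (\<Oplus>i\<in>{1..Suc m}. a i \<otimes> x [^] (Suc m - i))"
      using prod_adjoin_expand[OF K x] by blast
    have "x [^] Suc m \<oplus> (\<Oplus>i\<in>{1..Suc m}. a i \<otimes> x [^] (Suc m - i)) = \<zero>"
      using r_neg[OF nat_pow_closed[OF x]] by (simp only: a(2)[symmetric])
    then show "x \<in> integral_closure R K"
      unfolding integral_closure_def mem_Collect_eq
      using x a(1) by (intro conjI exI[of _ "Suc m"] exI[of _ a]) simp_all
  qed
qed (simp add: integral_closure_def)

text \<open>The power \<open>(K + (x))\<^sup>m\<^sup>+\<^sup>1\<close> lies in \<open>(x)\<^sup>m\<^sup>+\<^sup>1 + K (K + (x))\<^sup>m\<close> by \<open>pow_sum_subset\<close>, and for integral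
\<open>x\<close> the first summand is absorbed by the second.\<close>

lemma reduction_adjoin:
  assumes K: "ideal K R" and "x \<in> integral_closure R K"
  shows "reduction R K (K <+> PIdl x)"
proof -
  obtain m where x: "x \<in> carrier R" and m: "x [^] Suc m \<in> K \<cdot> ideal_pow R (K <+> PIdl x) m"
    using assms(2) integral_closure_iff[OF K] by blast
  let ?L = "K <+> PIdl x"
  note X = cgenideal_ideal[OF x]
  note L = add_ideals[OF K X]
  note V = ideal_prod_is_ideal[OF K ideal_pow_ideal[OF L]]
  have "ideal_pow R (PIdl x) (Suc m) \<subseteq> K \<cdot> ideal_pow R ?L m"
    using cgenideal_pow[OF x, of "Suc m"] cgenideal_minimal[OF V m] by blast
  then have "ideal_pow R ?L (Suc m) \<subseteq> K \<cdot> ideal_pow R ?L m"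
    using pow_sum_subset[OF X K, of m] sum_ideals_least[OF V _ order_refl]
    unfolding sum_ideals_comm[OF X K] by blast
  then show ?thesis by (intro reductionI[OF K L sum_ideals_upper(1)[OF K X]])
qed

lemma integral_closure_mono:
  assumes "K \<subseteq> L" shows "integral_closure R K \<subseteq> integral_closure R L"
  using ideal_pow_mono[OF assms] unfolding integral_closure_def by blast

text \<open>The determinant trick without determinants. Write \<open>V\<^sub>d\<close> for \<open>K (K + (x))\<^sup>d\<^sup>-\<^sup>1\<close>, so that
\<open>V\<^sub>d V\<^sub>e\<close> and \<open>x\<^sup>d V\<^sub>e\<close> lie in \<open>V\<^sub>d\<^sub>+\<^sub>e\<close>. If \<open>x\<^sup>d\<close> maps every generator into the \<open>V\<^sub>d\<close>-span of
all generators, solve the relation of one generator \<open>b\<close> for it: \<open>(x\<^sup>d - v) b = w\<close> with \<open>w\<close> in the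
\<open>V\<^sub>d\<close>-span of the others. Multiplying the relations of the others by \<open>x\<^sup>d - v\<close> eliminates \<open>b\<close> from
them, at the price of replacing \<open>d\<close> by \<open>2 d\<close>. A monic element that kills the other generators kills
\<open>w\<close>, so its product with \<open>x\<^sup>d - v\<close> kills \<open>b\<close> too.\<close>

lemma monic_relation_for_generators:
  assumes K: "ideal K R" and x: "x \<in> carrier R" and B: "finite B" "B \<subseteq> carrier R"
    and step: "\<And>b. b \<in> B \<Longrightarrow> x [^] Suc m \<otimes> b \<in> K \<cdot> ideal_pow R (K <+> PIdl x) m \<cdot> (Idl B)"
  shows "\<exists>k. \<exists>v \<in> K \<cdot> ideal_pow R (K <+> PIdl x) k. \<forall>b\<in>B. (x [^] Suc k \<ominus> v) \<otimes> b = \<zero>"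
  using B step
proof (induct B arbitrary: m)
  case empty
  show ?case
    by (intro exI[of _ 0] bexI[of _ \<zero>])
      (simp_all add: ideal_closed(1)[OF K] ideal_prod_one K)
next
  case (insert b B)
  let ?L = "K <+> PIdl x" let ?V = "\<lambda>m. K \<cdot> ideal_pow R ?L m"
  note X = cgenideal_ideal[OF x]
  note L = add_ideals[OF K X]
  note Lm = ideal_pow_ideal[OF L]
  have V: "ideal (?V m) R" for m by (rule ideal_prod_is_ideal[OF K Lm])
  have b: "b \<in> carrier R" and B: "B \<subseteq> carrier R" using insert.prems(1) by auto
  note J = genideal_ideal[OF B] and P = cgenideal_ideal[OF b]
  have VJ: "ideal (?V m \<cdot> (Idl B)) R" for m by (rule ideal_prod_is_ideal[OF V J])
  have xp: "x [^] n \<in> ideal_pow R ?L n" for n :: nat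
    using sum_ideals_upper(2)[OF K X] cgenideal_self[OF x] by (intro pow_in_ideal_pow[OF L]) blast
  have VL: "?V i \<cdot> ideal_pow R ?L j = ?V (i + j)" for i j
    by (simp add: ideal_prod_assoc[OF K Lm Lm] ideal_pow_add[OF L])
  have Vsub: "?V i \<subseteq> ideal_pow R ?L (Suc i)" for i
    using ideal_prod_mono[OF sum_ideals_upper(1)[OF K X] order_refl, of "ideal_pow R ?L i"]
    by (simp add: ideal_prod_commute[OF L Lm])
  have idl: "Idl (insert b B) = PIdl b <+> Idl B"
  proof
    show "Idl (insert b B) \<subseteq> PIdl b <+> Idl B"
      using sum_ideals_upper[OF P J] cgenideal_self[OF b] genideal_self[OF B]
      by (intro genideal_minimal add_ideals P J) auto
    show "PIdl b <+> Idl B \<subseteq> Idl (insert b B)"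
      using genideal_self[OF insert.prems(1)] genideal_ideal[OF insert.prems(1)]
      by (intro sum_ideals_least cgenideal_minimal genideal_minimal) auto
  qed
  have split: "\<exists>v \<in> ?V m. \<exists>w \<in> ?V m \<cdot> (Idl B). y = v \<otimes> b \<oplus> w"
    if y: "y \<in> ?V m \<cdot> (Idl (insert b B))" for y
  proof -
    obtain p w where pw: "p \<in> ?V m \<cdot> (PIdl b)" "w \<in> ?V m \<cdot> (Idl B)" "y = p \<oplus> w"
      using y unfolding idl ideal_prod_r_distr[OF V P J] mem_sum_ideals by blast
    have "\<exists>v \<in> ?V m. p = v \<otimes> b"
      using pw(1)
    proof (induct p rule: ideal_prod.induct)
      case (prod i j)
      then obtain r where r: "r \<in> carrier R" "j = r \<otimes> b" by (auto simp: cgenideal_def)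
      then show ?case using prod(1) ideal_closed(6,7)[OF V] b
        by (intro bexI[of _ "i \<otimes> r"]) (auto simp: m_assoc)
    next
      case (sum s t)
      then obtain v w where vw: "v \<in> ?V m" "s = v \<otimes> b" "w \<in> ?V m" "t = w \<otimes> b" by blast
      then show ?case using ideal_closed(2,7)[OF V] b
        by (intro bexI[of _ "v \<oplus> w"]) (auto simp: l_distr)
    qed
    then show ?thesis using pw by blast
  qed
  let ?d = "x [^] Suc m"
  obtain v w where vw: "v \<in> ?V m" "w \<in> ?V m \<cdot> (Idl B)" "?d \<otimes> b = v \<otimes> b \<oplus> w"
    using split[OF insert.prems(2)[of b]] by blast
  have dc: "?d \<in> carrier R" using x by blast
  have vc: "v \<in> carrier R" "w \<in> carrier R" using vw ideal_closed(7) V VJ by blast+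
  have "(?d \<ominus> v) \<otimes> b = ?d \<otimes> b \<ominus> v \<otimes> b" using dc vc b by (simp only: a_minus_def l_distr l_minus a_inv_closed)
  also have "\<dots> = w" unfolding vw(3) using vc b by algebra
  finally have ub: "(?d \<ominus> v) \<otimes> b = w" .
  \<comment> \<open>the degree \<open>Suc m\<close> doubles, and \<open>Suc ?M = Suc m + Suc m\<close>\<close>
  let ?M = "Suc (m + m)"
  have big: "y \<in> ?V ?M \<cdot> (Idl B)" if "y \<in> ideal_pow R ?L (Suc m) \<cdot> (?V m \<cdot> (Idl B))" for y
  proof -
    have "ideal_pow R ?L (Suc m) \<cdot> (?V m \<cdot> (Idl B)) = ?V (m + Suc m) \<cdot> (Idl B)"
      by (metis VL ideal_prod_assoc ideal_prod_commute Lm V J)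
    then show ?thesis using that by simp
  qed
  have "x [^] Suc ?M \<otimes> c \<in> ?V ?M \<cdot> (Idl B)" if c: "c \<in> B" for c
  proof -
    obtain v' w' where vw': "v' \<in> ?V m" "w' \<in> ?V m \<cdot> (Idl B)" "?d \<otimes> c = v' \<otimes> b \<oplus> w'"
      using split[OF insert.prems(2)[of c]] c by blast
    have cc: "c \<in> carrier R" "v' \<in> carrier R" "w' \<in> carrier R"
      using c B vw' ideal_closed(7) V VJ by blast+
    have dd: "x [^] Suc ?M = ?d \<otimes> ?d" using nat_pow_mult[OF x, of "Suc m" "Suc m"] by simp
    have "(?d \<ominus> v) \<otimes> (v' \<otimes> b) = v' \<otimes> w"
      unfolding ub[symmetric] using dc vc cc b by (simp add: m_ac del: nat_pow_Suc Group.nat_pow_Suc)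
    moreover have "?d \<otimes> ?d \<otimes> c = (v \<otimes> ?d) \<otimes> c \<oplus> (?d \<ominus> v) \<otimes> (?d \<otimes> c)"
    proof -
      have "y \<otimes> y \<otimes> c = (v \<otimes> y) \<otimes> c \<oplus> (y \<ominus> v) \<otimes> (y \<otimes> c)" if "y \<in> carrier R" for y
        using that vc cc by algebra
      then show ?thesis using dc by blast
    qed
    moreover have "(?d \<ominus> v) \<otimes> (?d \<otimes> c) = (?d \<ominus> v) \<otimes> (v' \<otimes> b) \<oplus> (?d \<ominus> v) \<otimes> w'"
      unfolding vw'(3) using dc vc cc b by (simp add: r_distr del: nat_pow_Suc Group.nat_pow_Suc)
    ultimately have eq: "x [^] Suc ?M \<otimes> c = (v \<otimes> ?d) \<otimes> c \<oplus> (v' \<otimes> w \<oplus> (?d \<ominus> v) \<otimes> w')"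
      using dd by simp
    have "v \<otimes> ?d \<in> ?V (m + Suc m)"
      unfolding VL[symmetric] by (rule ideal_prod.prod[OF vw(1) xp])
    then have "v \<otimes> ?d \<in> ?V ?M" by simp
    then have "(v \<otimes> ?d) \<otimes> c \<in> ?V ?M \<cdot> (Idl B)"
      by (rule ideal_prod.prod) (use genideal_self[OF B] c in auto)
    moreover have "v' \<otimes> w \<in> ?V ?M \<cdot> (Idl B)"
      using Vsub vw' vw by (intro big ideal_prod.prod) auto
    moreover have "(?d \<ominus> v) \<otimes> w' \<in> ?V ?M \<cdot> (Idl B)"
      using Vsub vw' vw xp by (intro big ideal_prod.prod ideal_closed(4)[OF Lm]) blast+
    ultimately show ?thesis unfolding eq using ideal_closed(2)[OF VJ] by blast
  qed
  then obtain k z where z: "z \<in> ?V k" "\<And>c. c \<in> B \<Longrightarrow> (x [^] Suc k \<ominus> z) \<otimes> c = \<zero>"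
    using insert.hyps(3)[OF B, of ?M] by blast
  let ?e = "x [^] Suc k"
  have ec: "?e \<in> carrier R" using x by blast
  have zc: "z \<in> carrier R" using z ideal_closed(7)[OF V] by blast
  have "w \<in> Idl B" using vw(2) ideal_prod_inter[OF V J] by blast
  then have zw: "(?e \<ominus> z) \<otimes> w = \<zero>"
    using Idl_mult_in_ideal[OF zeroideal minus_closed[OF ec zc] B] z(2) by blast
  \<comment> \<open>the product of the two monic elements is \<open>x\<close> to the power \<open>Suc (k + Suc m)\<close> minus \<open>y\<close>\<close>
  define y where "y = (?e \<otimes> v \<oplus> z \<otimes> ?d) \<ominus> z \<otimes> v"
  have yV: "y \<in> ?V (k + Suc m)"
    unfolding y_def
  proof (intro ideal_closed(2,4)[OF V])
    have "v \<otimes> ?e \<in> ?V (m + Suc k)" unfolding VL[symmetric] by (rule ideal_prod.prod[OF vw(1) xp])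
    then show "?e \<otimes> v \<in> ?V (k + Suc m)" using ec vc by (simp add: m_comm add.commute del: nat_pow_Suc Group.nat_pow_Suc)
    show "z \<otimes> ?d \<in> ?V (k + Suc m)" unfolding VL[symmetric] by (rule ideal_prod.prod[OF z(1) xp])
    show "z \<otimes> v \<in> ?V (k + Suc m)"
      unfolding VL[symmetric] using Vsub vw(1) by (intro ideal_prod.prod[OF z(1)]) auto
  qed
  have "x [^] Suc (k + Suc m) = ?e \<otimes> ?d" using nat_pow_mult[OF x, of "Suc k" "Suc m"] by simp
  moreover have "?e \<otimes> ?d \<ominus> y = (?e \<ominus> z) \<otimes> (?d \<ominus> v)"
  proof -
    have "p \<otimes> q \<ominus> ((p \<otimes> v \<oplus> z \<otimes> q) \<ominus> z \<otimes> v) = (p \<ominus> z) \<otimes> (q \<ominus> v)"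
      if "p \<in> carrier R" "q \<in> carrier R" for p q
      using that vc zc by algebra
    then show ?thesis unfolding y_def using dc ec by blast
  qed
  ultimately have fac: "x [^] Suc (k + Suc m) \<ominus> y = (?e \<ominus> z) \<otimes> (?d \<ominus> v)" by simp
  have "(x [^] Suc (k + Suc m) \<ominus> y) \<otimes> c = \<zero>" if c: "c \<in> insert b B" for c
  proof (cases "c = b")
    case True
    then show ?thesis unfolding fac using ub zw dc ec vc zc b
      by (simp add: m_assoc del: nat_pow_Suc Group.nat_pow_Suc)
  next
    case False
    then have c: "c \<in> B" using c by auto
    then have cc: "c \<in> carrier R" using B by auto
    have "(?e \<ominus> z) \<otimes> (?d \<ominus> v) \<otimes> c = (?d \<ominus> v) \<otimes> ((?e \<ominus> z) \<otimes> c)"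
      using dc ec vc zc cc by (simp add: m_ac del: nat_pow_Suc Group.nat_pow_Suc)
    then show ?thesis unfolding fac z(2)[OF c] using dc vc by simp
  qed
  then show ?case using yV by blast
qed

end

locale noetherian_cring = cring R + noetherian_ring R for R (structure)
begin

text \<open>Multiplication by \<open>x\<close> maps \<open>M\<^sup>s\<close> into \<open>M\<^sup>s\<^sup>+\<^sup>1 = K M\<^sup>s\<close>. The determinant trick, applied to
generators of \<open>M\<^sup>s\<close>, gives a monic element that kills \<open>M\<^sup>s\<close>. As \<open>x\<^sup>s\<close> belongs to \<open>M\<^sup>s\<close>, multiplying
the monic element by \<open>x\<^sup>s\<close> yields an equation of integral dependence, even when \<open>M\<^sup>s\<close> is not
faithful.\<close>

lemma integral_over_reduction:
  assumes red: "reduction R K M" and M: "ideal M R" and xM: "x \<in> M"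
  shows "x \<in> integral_closure R K"
proof -
  obtain s where s: "ideal_pow R M (Suc s) = K \<cdot> ideal_pow R M s" and K: "ideal K R"
    using red by (auto simp: reduction_def)
  have x: "x \<in> carrier R" using ideal_closed(7)[OF M xM] .
  let ?L = "K <+> PIdl x"
  note L = add_ideals[OF K cgenideal_ideal[OF x]]
  note Lm = ideal_pow_ideal[OF L]
  obtain B where B: "B \<subseteq> carrier R" "finite B" "ideal_pow R M s = Idl B"
    using finetely_gen[OF ideal_pow_ideal[OF M]] by blast
  have "x [^] Suc 0 \<otimes> b \<in> K \<cdot> ideal_pow R ?L 0 \<cdot> (Idl B)" if b: "b \<in> B" for b
  proof -
    have "b \<in> ideal_pow R M s" using b B genideal_self by blast
    then have "b \<otimes> x \<in> ideal_pow R M (Suc s)" using xM by (simp add: ideal_prod.prod)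
    then show ?thesis unfolding s using x b B by (simp add: m_comm ideal_prod_one K subset_iff)
  qed
  then obtain k v where v: "v \<in> K \<cdot> ideal_pow R ?L k" "\<And>b. b \<in> B \<Longrightarrow> (x [^] Suc k \<ominus> v) \<otimes> b = \<zero>"
    using monic_relation_for_generators[OF K x B(2,1)] by blast
  have vc: "v \<in> carrier R" using v(1) ideal_closed(7)[OF ideal_prod_is_ideal[OF K Lm]] by blast
  let ?e = "x [^] Suc k"
  have ec: "?e \<in> carrier R" using x by blast
  have "x [^] s \<in> Idl B" using pow_in_ideal_pow[OF M xM, of s] B(3) by simp
  then have 0: "(?e \<ominus> v) \<otimes> x [^] s = \<zero>"
    using Idl_mult_in_ideal[OF zeroideal minus_closed[OF ec vc] B(1)] v(2) by blast
  have xs: "x [^] s \<in> carrier R" using x by simp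
  have "?e \<otimes> x [^] s = (?e \<ominus> v) \<otimes> x [^] s \<oplus> v \<otimes> x [^] s"
  proof -
    have "p \<otimes> x [^] s = (p \<ominus> v) \<otimes> x [^] s \<oplus> v \<otimes> x [^] s" if "p \<in> carrier R" for p
      using that vc xs by algebra
    then show ?thesis using ec by blast
  qed
  then have "?e \<otimes> x [^] s = v \<otimes> x [^] s" unfolding 0 using vc xs by simp
  moreover have "x [^] Suc (k + s) = ?e \<otimes> x [^] s"
    using x nat_pow_mult[OF x, of "Suc k" s] by simp
  moreover have "v \<otimes> x [^] s \<in> K \<cdot> ideal_pow R ?L (k + s)"
  proof -
    have "x [^] s \<in> ideal_pow R ?L s"
      using sum_ideals_upper(2)[OF K cgenideal_ideal[OF x]] cgenideal_self[OF x]
      by (intro pow_in_ideal_pow[OF L]) blast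
    then show ?thesis
      unfolding ideal_pow_add[OF L, symmetric] ideal_prod_assoc[OF K Lm Lm, symmetric]
      by (intro ideal_prod.prod v(1))
  qed
  ultimately show ?thesis unfolding integral_closure_iff[OF K] using x by (metis)
qed

text \<open>Integral elements are adjoined one at a time. The step adds the ideal generated so far to
both sides of the reduction \<open>K \<subseteq> K + (b)\<close> and then uses transitivity.\<close>

lemma reduction_adjoin_finite:
  assumes K: "ideal K R" and "finite B" "B \<subseteq> integral_closure R K"
  shows "reduction R K (K <+> Idl B)"
  using assms(2,3)
proof (induct B)
  case empty
  have "K <+> Idl {} = K"
    using sum_ideals_comm[OF K genideal_ideal[of "{}"]] sum_ideals_absorb[OF genideal_ideal[of "{}"] K]
      genideal_minimal[OF K] by simp
  then show ?case using reduction_refl[OF K] by simp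
next
  case (insert b B)
  have c: "insert b B \<subseteq> carrier R" using insert.prems by (auto simp: integral_closure_def)
  then have b: "b \<in> carrier R" and B: "B \<subseteq> carrier R" by auto
  note J = genideal_ideal[OF B] and P = cgenideal_ideal[OF b]
  let ?N = "K <+> Idl B"
  note N = add_ideals[OF K J] and KP = add_ideals[OF K P]
  have KN: "K \<subseteq> ?N" by (rule sum_ideals_upper[OF K J])
  have IH: "reduction R K ?N" using insert by simp
  have "reduction R (K <+> ?N) (K <+> PIdl b <+> ?N)"
    using insert.prems by (intro reduction_add reduction_adjoin K N KP) auto
  then have *: "reduction R ?N (K <+> PIdl b <+> ?N)" using sum_ideals_absorb[OF K N KN] by simp
  have "K <+> PIdl b <+> ?N = K <+> Idl (insert b B)"
  proof
    note ic = genideal_ideal[OF c]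
    note up = sum_ideals_upper[OF K ic]
    have *: "insert b B \<subseteq> K <+> Idl (insert b B)" using up(2) genideal_self[OF c] by blast
    show "K <+> PIdl b <+> ?N \<subseteq> K <+> Idl (insert b B)"
      using up(1) * by (intro sum_ideals_least cgenideal_minimal genideal_minimal add_ideals K ic) auto
    note up2 = sum_ideals_upper[OF KP N] sum_ideals_upper[OF K P] sum_ideals_upper[OF K J]
    show "K <+> Idl (insert b B) \<subseteq> K <+> PIdl b <+> ?N"
      using up2 cgenideal_self[OF b] genideal_self[OF B]
      by (intro sum_ideals_least genideal_minimal add_ideals[OF KP N]) blast+
  qed
  then show ?case using reduction_trans[OF IH *] N add_ideals[OF K genideal_ideal[OF c]] by simp
qed

text \<open>For finitely many elements integral over \<open>K\<close>, the ideal \<open>K\<close> is a reduction of the ideal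
obtained by adjoining them, so that all elements of the latter are integral over \<open>K\<close>.\<close>

lemma integral_closure_ideal:
  assumes K: "ideal K R"
  shows "ideal (integral_closure R K) R"
proof -
  have fin: "Idl B \<subseteq> integral_closure R K" if "finite B" "B \<subseteq> integral_closure R K" for B
  proof -
    have Bc: "B \<subseteq> carrier R" using that(2) by (auto simp: integral_closure_def)
    note J = genideal_ideal[OF Bc]
    show ?thesis
      using integral_over_reduction[OF reduction_adjoin_finite[OF K that] add_ideals[OF K J]]
        sum_ideals_upper(2)[OF K J] by blast
  qed
  show ?thesis
  proof (rule ideal_criterion)
    show c: "integral_closure R K \<subseteq> carrier R" by (auto simp: integral_closure_def)
    show "\<zero> \<in> integral_closure R K"
      using fin[of "{}"] ideal_closed(1)[OF genideal_ideal[of "{}"]] by auto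
    fix y assume y: "y \<in> integral_closure R K"
    show "x \<oplus> y \<in> integral_closure R K" if x: "x \<in> integral_closure R K" for x
    proof -
      have s: "{x, y} \<subseteq> carrier R" using x y c by auto
      have "x \<oplus> y \<in> Idl {x, y}"
        using genideal_self[OF s] ideal_closed(2)[OF genideal_ideal[OF s]] by auto
      then show ?thesis using fin[of "{x, y}"] x y by auto
    qed
    show "r \<otimes> y \<in> integral_closure R K" if r: "r \<in> carrier R" for r
    proof -
      have s: "{y} \<subseteq> carrier R" using y c by auto
      have "r \<otimes> y \<in> Idl {y}"
        using genideal_self[OF s] ideal_closed(5)[OF genideal_ideal[OF s] r] by auto
      then show ?thesis using fin[of "{y}"] y by auto
    qed
  qed
qed

lemma reduction_if_integral:
  assumes K: "ideal K R" and I: "ideal I R" and "K \<subseteq> I" "I \<subseteq> integral_closure R K"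
  shows "reduction R K I"
proof -
  obtain B where B: "B \<subseteq> carrier R" "finite B" "I = Idl B" using finetely_gen[OF I] by blast
  then have "reduction R K (K <+> I)"
    using genideal_self[OF B(1)] assms(4) by (auto intro: reduction_adjoin_finite[OF K])
  then show ?thesis using sum_ideals_absorb[OF K I assms(3)] by simp
qed

text \<open>For \<open>x\<close> integral over \<open>L\<close>, the chain \<open>K \<subseteq> L \<subseteq> L + (x)\<close> consists of reductions, so
\<open>x\<close> is integral over \<open>K\<close> by transitivity.\<close>

lemma integral_closure_reduction:
  assumes "reduction R K L" "ideal L R"
  shows "integral_closure R K = integral_closure R L"
proof
  have K: "ideal K R" "K \<subseteq> L" using assms(1) by (auto simp: reduction_def)
  show "integral_closure R K \<subseteq> integral_closure R L" by (rule integral_closure_mono[OF K(2)])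
  show "integral_closure R L \<subseteq> integral_closure R K"
  proof
    fix x assume x: "x \<in> integral_closure R L"
    then have xc: "x \<in> carrier R" by (simp add: integral_closure_def)
    note P = cgenideal_ideal[OF xc]
    have "reduction R K (L <+> PIdl x)"
      by (rule reduction_trans[OF assms(1) reduction_adjoin[OF assms(2) x] assms(2)
            add_ideals[OF assms(2) P]])
    then show "x \<in> integral_closure R K"
      using integral_over_reduction add_ideals[OF assms(2) P] sum_ideals_upper(2)[OF assms(2) P]
        cgenideal_self[OF xc] by blast
  qed
qed

end

section \<open>Noetherian local rings\<close>

context noetherian_cring
begin

lemma noetherian_induct [consumes 1, case_names step]:
  assumes "ideal Q R"
    and step: "\<And>Q. ideal Q R \<Longrightarrow> (\<And>Q'. ideal Q' R \<Longrightarrow> Q \<subset> Q' \<Longrightarrow> P Q') \<Longrightarrow> P Q"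
  shows "P Q"
proof (rule ccontr)
  assume "\<not> P Q"
  let ?S = "{Q. ideal Q R \<and> \<not> P Q}"
  have "\<Union>C \<in> ?S" if "C \<noteq> {}" "subset.chain ?S C" for C
  proof -
    have "subset.chain {I. ideal I R} C" using that(2) by (auto simp: subset_chain_def)
    then have "\<Union>C \<in> C" by (rule ideal_chain_is_trivial[OF that(1)])
    then show ?thesis using that(2) by (auto simp: subset_chain_def)
  qed
  moreover have "?S \<noteq> {}" using \<open>\<not> P Q\<close> assms(1) by auto
  ultimately have "\<exists>M\<in>?S. \<forall>Z\<in>?S. M \<subseteq> Z \<longrightarrow> Z = M" by (intro subset_Zorn_nonempty) auto
  then obtain M where M: "M \<in> ?S" "\<And>Z. Z \<in> ?S \<Longrightarrow> M \<subseteq> Z \<Longrightarrow> Z = M" by blast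
  have "P M"
  proof (rule step)
    fix Q' assume "ideal Q' R" "M \<subset> Q'"
    then show "P Q'" using M(2)[of Q'] by auto
  qed (use M in auto)
  then show False using M(1) by simp
qed

lemma proper_ideal_in_maximal:
  assumes "ideal Q R" "Q \<noteq> carrier R"
  shows "\<exists>\<nn>. maximalideal \<nn> R \<and> Q \<subseteq> \<nn>"
  using assms
proof (induct Q rule: noetherian_induct)
  case (step Q)
  show ?case
  proof (cases "maximalideal Q R")
    case False
    then obtain Q' where "ideal Q' R" "Q \<subset> Q'" "Q' \<noteq> carrier R"
      using step(1,3) ideal_closed(7) maximalidealI[OF step(1)] by (metis psubsetI subsetI)
    then show ?thesis using step(2) by blast
  qed auto
qed

end

sublocale complete_noetherian_local_ring \<subseteq> noetherian_cring ..

lemma (in cring) add_minus_cancel_left: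
  assumes "x \<in> carrier R" "y \<in> carrier R"
  shows "(x \<oplus> y) \<ominus> x = y"
  using assms by (simp add: a_minus_def a_comm[of x y] a_assoc r_neg)

context complete_noetherian_local_ring
begin

lemma proper_ideal_le:
  assumes "ideal Q R" "Q \<noteq> carrier R" shows "Q \<subseteq> \<mm>"
  using proper_ideal_in_maximal[OF assms] unique_maximal by blast

lemma max_ideal: "ideal \<mm> R"
  using maximal by (simp add: maximalideal_def)

text \<open>The colon ideal \<open>Q : x\<close> is proper when \<open>x\<close> is not in \<open>Q\<close>, hence lies in the maximal ideal.\<close>

lemma multiplier_in_maximal:
  assumes "ideal Q R" "x \<in> carrier R" "x \<notin> Q" "r \<in> carrier R" "r \<otimes> x \<in> Q"
  shows "r \<in> \<mm>"
proof -
  have "\<one> \<notin> {r \<in> carrier R. r \<otimes> x \<in> Q}" using assms by simp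
  then have "{r \<in> carrier R. r \<otimes> x \<in> Q} \<noteq> carrier R" by blast
  then show ?thesis using proper_ideal_le[OF quotient_by_element_ideal[OF assms(1,2)]] assms by auto
qed

end

section \<open>Chevalley's theorem on directed families of ideals\<close>

context complete_noetherian_local_ring
begin

text \<open>This is the descending chain condition for \<open>R / Q\<close>, for directed families and for \<open>Q\<close>
containing a power of \<open>\<mm>\<close>. By Noetherian induction it may be assumed for \<open>Q + (x)\<close>, where \<open>x\<close> is a
socle element of \<open>R / Q\<close>, that is, \<open>x \<notin> Q\<close> and \<open>\<mm> x \<subseteq> Q\<close>. If \<open>x\<close> lies in all \<open>P + Q\<close>, the
conclusion for \<open>Q + (x)\<close> is the conclusion for \<open>Q\<close>. Otherwise pass to a member inside some \<open>P\<^sub>1\<close> with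
\<open>x \<notin> P\<^sub>1 + Q\<close>: a multiple \<open>r x\<close> that lies in \<open>P\<^sub>1 + Q\<close> then has \<open>r \<in> \<mm>\<close>, so it already lies in
\<open>Q\<close>.\<close>

lemma directed_family_stabilizes:
  assumes S: "\<And>P. P \<in> S \<Longrightarrow> ideal P R" "S \<noteq> {}"
    and dir: "\<And>A B. A \<in> S \<Longrightarrow> B \<in> S \<Longrightarrow> \<exists>C\<in>S. C \<subseteq> A \<inter> B"
    and Q: "ideal Q R" "ideal_pow R \<mm> t \<subseteq> Q"
  shows "\<exists>P0\<in>S. \<forall>P\<in>S. P0 \<subseteq> P <+> Q"
  using Q
proof (induct Q rule: noetherian_induct)
  case (step Q)
  show ?case
  proof (cases "Q = carrier R")
    case True
    then show ?thesis
      using S sum_ideals_upper(2)[OF _ step(1)] ideal_closed(7) by (metis ex_in_conv subset_iff)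
  next
    case False
    \<comment> \<open>an element of the last power of \<open>\<mm>\<close> not contained in \<open>Q\<close> is a socle element of \<open>R / Q\<close>\<close>
    define u where "u = (LEAST u. ideal_pow R \<mm> u \<subseteq> Q)"
    have u: "ideal_pow R \<mm> u \<subseteq> Q" unfolding u_def using step(3) by (rule LeastI)
    have "u \<noteq> 0" using u False ideal_closed(7)[OF step(1)] by (metis nat_pow_0 ideals_set_simps(1) Group.nat_pow_0 subsetI subset_antisym)
    then obtain w where w: "u = Suc w" using not0_implies_Suc by blast
    have "\<not> ideal_pow R \<mm> w \<subseteq> Q" using not_less_Least[of w "\<lambda>u. ideal_pow R \<mm> u \<subseteq> Q"] w u_def by simp
    then obtain x where x: "x \<in> ideal_pow R \<mm> w" "x \<notin> Q" by blast
    have xc: "x \<in> carrier R" using ideal_closed(7)[OF ideal_pow_ideal[OF max_ideal] x(1)] .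
    have mx: "r \<otimes> x \<in> Q" if "r \<in> \<mm>" for r
    proof -
      have "x \<otimes> r \<in> Q" using u w x(1) that ideal_prod.prod[of x _ r \<mm> R] by auto
      then show ?thesis using xc ideal_closed(7)[OF max_ideal that] by (simp add: m_comm)
    qed
    note X = cgenideal_ideal[OF xc]
    let ?Q = "Q <+> PIdl x"
    note up = sum_ideals_upper[OF step(1) X]
    have "\<exists>P0\<in>S. \<forall>P\<in>S. P0 \<subseteq> P <+> ?Q"
      using up x(2) cgenideal_self[OF xc] step(3) by (intro step(2) add_ideals step(1) X) blast+
    then obtain P0 where P0: "P0 \<in> S" "\<And>P. P \<in> S \<Longrightarrow> P0 \<subseteq> P <+> ?Q" by blast
    have PQ: "ideal (P <+> Q) R" if "P \<in> S" for P using S(1)[OF that] step(1) by (rule add_ideals)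
    show ?thesis
    proof (cases "\<exists>P1\<in>S. x \<notin> P1 <+> Q")
      case False
      have "P0 \<subseteq> P <+> Q" if P: "P \<in> S" for P
      proof -
        note pu = sum_ideals_upper[OF S(1)[OF P] step(1)]
        have "P <+> ?Q \<subseteq> P <+> Q"
          using False P pu by (intro sum_ideals_least PQ cgenideal_minimal) auto
        then show ?thesis using P0(2)[OF P] by blast
      qed
      then show ?thesis using P0(1) by blast
    next
      case True
      then obtain P1 where P1: "P1 \<in> S" "x \<notin> P1 <+> Q" by blast
      obtain P2 where P2: "P2 \<in> S" "P2 \<subseteq> P0 \<inter> P1" using dir[OF P0(1) P1(1)] by blast
      have "P2 \<subseteq> P <+> Q" if P: "P \<in> S" for P
      proof
        fix y assume y: "y \<in> P2"
        \<comment> \<open>a member inside \<open>P\<close> and \<open>P2\<close>, so that the remainder \<open>y \<ominus> p\<close> stays in \<open>P1\<close>\<close>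
        obtain P3 where P3: "P3 \<in> S" "P3 \<subseteq> P \<inter> P2" using dir[OF P P2(1)] by blast
        have "y \<in> P3 <+> ?Q" using P0(2)[OF P3(1)] P2(2) y by blast
        then obtain p z where p: "p \<in> P3" and z: "z \<in> ?Q" and "y = p \<oplus> z"
          by (blast dest: mem_sum_ideals[THEN iffD1])
        obtain q w where q: "q \<in> Q" "w \<in> PIdl x" "z = q \<oplus> w"
          using mem_sum_ideals[THEN iffD1, OF z] by blast
        obtain r where r: "r \<in> carrier R" "w = r \<otimes> x" using q(2) unfolding cgenideal_def by blast
        have pqr: "p \<in> P3" "q \<in> Q" "r \<in> carrier R" "y = p \<oplus> (q \<oplus> r \<otimes> x)"
          using p q r \<open>y = p \<oplus> z\<close> by simp_all
        have c: "p \<in> carrier R" "q \<in> carrier R"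
          using ideal_closed(7)[OF S(1)[OF P3(1)] pqr(1)] ideal_closed(7)[OF step(1) pqr(2)] by simp_all
        have "r \<otimes> x = (y \<ominus> p) \<ominus> q"
          unfolding pqr(4) using c pqr(3) xc by (simp add: add_minus_cancel_left)
        moreover have "y \<ominus> p \<in> P1"
          using y pqr(1) P3(2) P2(2) by (intro ideal_closed(4)[OF S(1)[OF P1(1)]]) auto
        ultimately have "r \<otimes> x \<in> P1 <+> Q"
          using sum_ideals_upper[OF S(1)[OF P1(1)] step(1)] pqr(2)
            ideal_closed(4)[OF PQ[OF P1(1)]] by auto
        then have "r \<otimes> x \<in> Q" by (intro mx multiplier_in_maximal[OF PQ[OF P1(1)] xc P1(2) pqr(3)])
        then have "q \<oplus> r \<otimes> x \<in> Q" using pqr(2) ideal_closed(2)[OF step(1)] by blast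
        moreover have "p \<in> P" using pqr(1) P3(2) by blast
        ultimately show "y \<in> P <+> Q" unfolding mem_sum_ideals using pqr(4) by metis
      qed
      then show ?thesis using P2(1) by blast
    qed
  qed
qed

text \<open>Chevalley's theorem: in a complete ring, a directed family of closed ideals gets arbitrarily
close to its intersection. Choose a descending sequence of members \<open>F\<^sub>n\<close> that are stable modulo
\<open>\<mm>\<^sup>n\<close>. Stability allows an element \<open>y\<close> of \<open>F\<^sub>t\<close> to be moved into \<open>F\<^sub>t\<^sub>+\<^sub>1\<close>, \<open>F\<^sub>t\<^sub>+\<^sub>2\<close>, and so on,
changing it by elements of \<open>\<mm>\<^sup>t\<close>, \<open>\<mm>\<^sup>t\<^sup>+\<^sup>1\<close>, and so on. The limit lies in every member of the family
and is congruent to \<open>y\<close> modulo \<open>\<mm>\<^sup>t\<close>.\<close>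

lemma directed_family_member_in_neighbourhood:
  assumes S: "\<And>P. P \<in> S \<Longrightarrow> ideal P R" "S \<noteq> {}"
    and dir: "\<And>A B. A \<in> S \<Longrightarrow> B \<in> S \<Longrightarrow> \<exists>C\<in>S. C \<subseteq> A \<inter> B"
    and closed: "\<And>P x. P \<in> S \<Longrightarrow> x \<in> carrier R \<Longrightarrow> (\<And>t. x \<in> P <+> ideal_pow R \<mm> t) \<Longrightarrow> x \<in> P"
  shows "\<exists>P\<in>S. P \<subseteq> \<Inter>S <+> ideal_pow R \<mm> t"
proof -
  note mt = ideal_pow_ideal[OF max_ideal]
  define good where "good t F \<longleftrightarrow> F \<in> S \<and> (\<forall>P\<in>S. F \<subseteq> P <+> ideal_pow R \<mm> t)" for t F
  have ex: "\<exists>F. good t F" for t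
    using directed_family_stabilizes[OF S dir mt order_refl] unfolding good_def by blast
  have "\<exists>F. \<forall>n. good n (F n) \<and> F (Suc n) \<subseteq> F n"
  proof (rule dependent_nat_choice[where P = good and Q = "\<lambda>_ A B. B \<subseteq> A"])
    show "\<exists>F. good 0 F" by (rule ex)
    fix F n assume F: "good n F"
    obtain G where G: "good (Suc n) G" using ex by blast
    obtain C where "C \<in> S" "C \<subseteq> F \<inter> G" using dir F G unfolding good_def by blast
    then show "\<exists>C. good (Suc n) C \<and> C \<subseteq> F" using G unfolding good_def by blast
  qed
  then obtain F where F: "\<And>n. F n \<in> S" "\<And>n P. P \<in> S \<Longrightarrow> F n \<subseteq> P <+> ideal_pow R \<mm> n"
    "\<And>n. F (Suc n) \<subseteq> F n" unfolding good_def by blast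
  have Int: "ideal (\<Inter>S) R" using S by (intro i_Intersect) auto
  have "y \<in> \<Inter>S <+> ideal_pow R \<mm> t" if y: "y \<in> F t" for y
  proof -
    have "\<exists>s. \<forall>n. (s n \<in> F (t + n) \<and> (n = 0 \<longrightarrow> s n = y)) \<and> s (Suc n) \<ominus> s n \<in> ideal_pow R \<mm> (t + n)"
    proof (rule dependent_nat_choice[where P = "\<lambda>n z. z \<in> F (t + n) \<and> (n = 0 \<longrightarrow> z = y)"
          and Q = "\<lambda>n z z'. z' \<ominus> z \<in> ideal_pow R \<mm> (t + n)"])
      show "\<exists>z. z \<in> F (t + 0) \<and> (0 = (0::nat) \<longrightarrow> z = y)" using y by auto
      fix z n assume "z \<in> F (t + n) \<and> (n = 0 \<longrightarrow> z = y)"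
      then have "z \<in> F (t + Suc n) <+> ideal_pow R \<mm> (t + n)" using F(1,2) by blast
      then obtain p q where pq: "p \<in> F (t + Suc n)" "q \<in> ideal_pow R \<mm> (t + n)" "z = p \<oplus> q"
        unfolding mem_sum_ideals by blast
      have c: "p \<in> carrier R" "q \<in> carrier R"
        using ideal_closed(7)[OF S(1)[OF F(1)] pq(1)] ideal_closed(7)[OF mt pq(2)] by auto
      have "p \<ominus> z = \<ominus> q" unfolding pq(3) using c by algebra
      then have "p \<ominus> z \<in> ideal_pow R \<mm> (t + n)" using ideal_closed(3)[OF mt pq(2)] by simp
      then show "\<exists>z'. (z' \<in> F (t + Suc n) \<and> (Suc n = 0 \<longrightarrow> z' = y)) \<and>
          z' \<ominus> z \<in> ideal_pow R \<mm> (t + n)" using pq(1) by blast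
    qed
    then obtain s where s: "\<And>n. s n \<in> F (t + n)" "s 0 = y"
      "\<And>n. s (Suc n) \<ominus> s n \<in> ideal_pow R \<mm> (t + n)" by blast
    have sc: "s n \<in> carrier R" for n using ideal_closed(7)[OF S(1)[OF F(1)] s(1)] .
    have diff: "s (n + k) \<ominus> s n \<in> ideal_pow R \<mm> (t + n)" for n k
    proof (induct k)
      case 0
      then show ?case using sc ideal_closed(1)[OF mt] by (simp add: r_neg a_minus_def)
    next
      case (Suc k)
      have "s (Suc (n + k)) \<ominus> s (n + k) \<in> ideal_pow R \<mm> (t + n)"
        using s(3)[of "n + k"] ideal_pow_antimono[OF max_ideal, of "t + n" "t + (n + k)"] by auto
      moreover have "s (n + Suc k) \<ominus> s n = (s (Suc (n + k)) \<ominus> s (n + k)) \<oplus> (s (n + k) \<ominus> s n)"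
      proof -
        have "a \<ominus> c = (a \<ominus> b) \<oplus> (b \<ominus> c)"
          if "a \<in> carrier R" "b \<in> carrier R" "c \<in> carrier R" for a b c using that by algebra
        from this[OF sc sc sc] show ?thesis by simp
      qed
      ultimately show ?case using Suc ideal_closed(2)[OF mt] by simp
    qed
    have "adic_cauchy R \<mm> s"
      unfolding adic_cauchy_def
    proof (intro allI exI impI)
      fix n i j :: nat assume ij: "n \<le> i" "n \<le> j"
      have "s i \<ominus> s n \<in> ideal_pow R \<mm> n" "s j \<ominus> s n \<in> ideal_pow R \<mm> n"
        using diff[of n "i - n"] diff[of n "j - n"] ij
          ideal_pow_antimono[OF max_ideal, of n "t + n"] by auto
      then have "(s i \<ominus> s n) \<ominus> (s j \<ominus> s n) \<in> ideal_pow R \<mm> n" by (rule ideal_closed(4)[OF mt])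
      moreover have "(a \<ominus> c) \<ominus> (b \<ominus> c) = a \<ominus> b"
        if "a \<in> carrier R" "b \<in> carrier R" "c \<in> carrier R" for a b c using that by algebra
      ultimately show "s i \<ominus> s j \<in> ideal_pow R \<mm> n" using sc by simp
    qed
    then obtain x where x: "x \<in> carrier R" "adic_limit R \<mm> s x"
      using complete sc unfolding adic_complete_def by blast
    have lim: "\<exists>i\<ge>n. s i \<ominus> x \<in> ideal_pow R \<mm> n" for n
    proof -
      obtain N where "\<forall>i\<ge>N. s i \<ominus> x \<in> ideal_pow R \<mm> n" using x(2) unfolding adic_limit_def by blast
      then show ?thesis by (intro exI[of _ "max n N"]) auto
    qed
    have "x \<in> P" if P: "P \<in> S" for P
    proof (rule closed[OF P x(1)])
      fix n
      obtain i where i: "i \<ge> n" "s i \<ominus> x \<in> ideal_pow R \<mm> n" using lim by blast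
      note id = add_ideals[OF S(1)[OF P] mt[of n]]
      note up = sum_ideals_upper[OF S(1)[OF P] mt[of n]]
      have "s i \<in> P <+> ideal_pow R \<mm> (t + i)" using F(2)[OF P] s(1) by blast
      moreover have "P <+> ideal_pow R \<mm> (t + i) \<subseteq> P <+> ideal_pow R \<mm> n"
        using up ideal_pow_antimono[OF max_ideal, of n "t + i"] i
        by (intro sum_ideals_least id) auto
      ultimately have "s i \<in> P <+> ideal_pow R \<mm> n" by (rule rev_subsetD)
      then have "s i \<ominus> (s i \<ominus> x) \<in> P <+> ideal_pow R \<mm> n"
        by (rule ideal_closed(4)[OF id _ subsetD[OF up(2) i(2)]])
      moreover have "s i \<ominus> (s i \<ominus> x) = x"
      proof -
        have "a \<ominus> (a \<ominus> x) = x" if "a \<in> carrier R" for a using that x(1) by algebra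
        then show ?thesis using sc by blast
      qed
      ultimately show "x \<in> P <+> ideal_pow R \<mm> n" by simp
    qed
    then have xS: "x \<in> \<Inter>S" by blast
    obtain i where i: "s i \<ominus> x \<in> ideal_pow R \<mm> t" using lim by blast
    have "s i \<ominus> y \<in> ideal_pow R \<mm> t" using diff[of 0 i] s(2) by simp
    then have "(s i \<ominus> x) \<ominus> (s i \<ominus> y) \<in> ideal_pow R \<mm> t" by (rule ideal_closed(4)[OF mt i])
    moreover have "y = x \<oplus> ((a \<ominus> x) \<ominus> (a \<ominus> y))" if "a \<in> carrier R" for a
    proof -
      have "y \<in> carrier R" using sc[of 0] s(2) by simp
      then show ?thesis using that x(1) by algebra
    qed
    ultimately show ?thesis using xS sc unfolding mem_sum_ideals by blast
  qed
  then show ?thesis using F(1) by blast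
qed

end

section \<open>Annihilators in an injective module\<close>

context module
begin

lemma smult_left_commute:
  assumes "a \<in> carrier R" "b \<in> carrier R" "x \<in> carrier M"
  shows "a \<odot>\<^bsub>M\<^esub> (b \<odot>\<^bsub>M\<^esub> x) = b \<odot>\<^bsub>M\<^esub> (a \<odot>\<^bsub>M\<^esub> x)"
  by (metis R.m_comm smult_assoc1 assms)

lemma mod_ann_submodule:
  assumes "K \<subseteq> carrier R"
  shows "submodule (mod_ann R M K) R M"
proof (rule submoduleI)
  fix a x assume a: "a \<in> carrier R" and x: "x \<in> mod_ann R M K"
  have "k \<odot>\<^bsub>M\<^esub> (a \<odot>\<^bsub>M\<^esub> x) = \<zero>\<^bsub>M\<^esub>" if k: "k \<in> K" for k
  proof -
    have c: "k \<in> carrier R" "x \<in> carrier M" "k \<odot>\<^bsub>M\<^esub> x = \<zero>\<^bsub>M\<^esub>"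
      using k assms x by (auto simp: mod_ann_def)
    have "k \<odot>\<^bsub>M\<^esub> (a \<odot>\<^bsub>M\<^esub> x) = a \<odot>\<^bsub>M\<^esub> (k \<odot>\<^bsub>M\<^esub> x)"
      by (rule smult_left_commute[OF c(1) a c(2)])
    then show ?thesis using a c by simp
  qed
  then show "a \<odot>\<^bsub>M\<^esub> x \<in> mod_ann R M K" using a x by (auto simp: mod_ann_def)
qed (use assms in \<open>auto simp: mod_ann_def smult_r_distr smult_r_minus\<close>)

lemma ring_ann_ideal:
  assumes "A \<subseteq> carrier M"
  shows "ideal (ring_ann R M A) R"
  by (rule R.ideal_criterion)
    (use assms in \<open>auto simp: ring_ann_def smult_l_distr smult_assoc1\<close>)

lemma cyclic_submodule:
  assumes e: "e \<in> carrier M"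
  shows "submodule ((\<lambda>r. r \<odot>\<^bsub>M\<^esub> e) ` carrier R) R M"
proof (rule submoduleI)
  show "\<zero>\<^bsub>M\<^esub> \<in> (\<lambda>r. r \<odot>\<^bsub>M\<^esub> e) ` carrier R"
    using smult_l_null[OF e] by (intro image_eqI[of _ _ \<zero>]) auto
  fix x assume "x \<in> (\<lambda>r. r \<odot>\<^bsub>M\<^esub> e) ` carrier R"
  then obtain r where r: "r \<in> carrier R" "x = r \<odot>\<^bsub>M\<^esub> e" by blast
  show "\<ominus>\<^bsub>M\<^esub> x \<in> (\<lambda>r. r \<odot>\<^bsub>M\<^esub> e) ` carrier R"
    using r smult_l_minus[OF r(1) e] by (intro image_eqI[of _ _ "\<ominus> r"]) auto
  show "a \<odot>\<^bsub>M\<^esub> x \<in> (\<lambda>r. r \<odot>\<^bsub>M\<^esub> e) ` carrier R" if "a \<in> carrier R" for a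
    using r smult_assoc1[OF that r(1) e] that by (intro image_eqI[of _ _ "a \<otimes> r"]) auto
  fix y assume "y \<in> (\<lambda>r. r \<odot>\<^bsub>M\<^esub> e) ` carrier R"
  then obtain s where s: "s \<in> carrier R" "y = s \<odot>\<^bsub>M\<^esub> e" by blast
  show "x \<oplus>\<^bsub>M\<^esub> y \<in> (\<lambda>r. r \<odot>\<^bsub>M\<^esub> e) ` carrier R"
    using r s smult_l_distr[OF r(1) s(1) e] by (intro image_eqI[of _ _ "r \<oplus> s"]) auto
qed (use e in auto)

lemma submodule_generated_submodule:
  assumes "S \<subseteq> carrier M"
  shows "submodule (submodule_generated R M S) R M"
proof (rule submoduleI)
  show "submodule_generated R M S \<subseteq> carrier M"
    using assms carrier_is_submodule by (auto simp: submodule_generated_def)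
  show "\<zero>\<^bsub>M\<^esub> \<in> submodule_generated R M S"
    using subgroup.one_closed[OF submodule.axioms(1)] by (fastforce simp: submodule_generated_def)
qed (use submoduleE in \<open>auto simp: submodule_generated_def\<close>)

lemma submodule_generated_least:
  "submodule N R M \<Longrightarrow> S \<subseteq> N \<Longrightarrow> submodule_generated R M S \<subseteq> N"
  by (auto simp: submodule_generated_def)

lemma submodule_generated_incl: "S \<subseteq> submodule_generated R M S"
  by (auto simp: submodule_generated_def)

end

locale injective_over_noetherian = noetherian_cring R + E: module R E
  for R :: "('a, 'r) ring_scheme" (structure) and E :: "('a, 'b, 'e) module_scheme" +
  assumes injective: "injective_module TYPE('a) R E"
begin

text \<open>The single use of Baer's criterion. The rule \<open>k + s r \<mapsto> s e\<close> is a well-defined linear map on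
\<open>K + S r\<close> precisely because of the compatibility assumption, and an element \<open>f\<close> that represents it is
killed by \<open>K\<close>. Taking \<open>S = R\<close> solves the equation \<open>r f = e\<close> in \<open>0 :\<^sub>E K\<close>; taking \<open>r = 1\<close> prescribes
the action of the ideal \<open>S\<close> on an element of \<open>0 :\<^sub>E K\<close>.\<close>

lemma solve_in_injective:
  assumes K: "ideal K R" and S: "ideal S R" and r: "r \<in> carrier R" and e: "e \<in> carrier E"
    and compat: "\<And>s. s \<in> S \<Longrightarrow> s \<otimes> r \<in> K \<Longrightarrow> s \<odot>\<^bsub>E\<^esub> e = \<zero>\<^bsub>E\<^esub>"
  shows "\<exists>f \<in> mod_ann R E K. \<forall>s\<in>S. (s \<otimes> r) \<odot>\<^bsub>E\<^esub> f = s \<odot>\<^bsub>E\<^esub> e"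
proof -
  define Q where "Q = {x \<in> carrier R. \<exists>s\<in>S. x \<ominus> s \<otimes> r \<in> K}"
  \<comment> \<open>the value does not depend on the chosen \<open>s\<close>, by compatibility\<close>
  define \<phi> where "\<phi> x = (SOME s. s \<in> S \<and> x \<ominus> s \<otimes> r \<in> K) \<odot>\<^bsub>E\<^esub> e" for x
  have Sc: "s \<in> carrier R" if "s \<in> S" for s using ideal_closed(7)[OF S that] .
  have val: "\<phi> x = s \<odot>\<^bsub>E\<^esub> e" if s: "s \<in> S" "x \<in> carrier R" "x \<ominus> s \<otimes> r \<in> K" for x s
  proof -
    define s' where "s' = (SOME s. s \<in> S \<and> x \<ominus> s \<otimes> r \<in> K)"
    have s': "s' \<in> S" "x \<ominus> s' \<otimes> r \<in> K"
      using someI[of "\<lambda>s. s \<in> S \<and> x \<ominus> s \<otimes> r \<in> K" s] s unfolding s'_def by auto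
    note c = Sc[OF s(1)] Sc[OF s'(1)]
    have "(s' \<ominus> s) \<otimes> r = (x \<ominus> s \<otimes> r) \<ominus> (x \<ominus> s' \<otimes> r)"
      using c r s(2) by algebra
    also have "\<dots> \<in> K" by (rule ideal_closed(4)[OF K s(3) s'(2)])
    finally have "(s' \<ominus> s) \<odot>\<^bsub>E\<^esub> e = \<zero>\<^bsub>E\<^esub>"
      by (intro compat ideal_closed(4)[OF S s'(1) s(1)])
    moreover have "s' \<odot>\<^bsub>E\<^esub> e = (s' \<ominus> s) \<odot>\<^bsub>E\<^esub> e \<oplus>\<^bsub>E\<^esub> s \<odot>\<^bsub>E\<^esub> e"
    proof -
      have "s' = (s' \<ominus> s) \<oplus> s" using c by algebra
      then show ?thesis using c e E.smult_l_distr[of "s' \<ominus> s" s e] by simp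
    qed
    ultimately have "s' \<odot>\<^bsub>E\<^esub> e = s \<odot>\<^bsub>E\<^esub> e" using c e by simp
    then show ?thesis by (simp add: \<phi>_def s'_def)
  qed
  have Qadd: "x \<oplus> y \<in> Q \<and> \<phi> (x \<oplus> y) = \<phi> x \<oplus>\<^bsub>E\<^esub> \<phi> y" if xy: "x \<in> Q" "y \<in> Q" for x y
  proof -
    obtain s t where st: "s \<in> S" "x \<ominus> s \<otimes> r \<in> K" "t \<in> S" "y \<ominus> t \<otimes> r \<in> K"
      using xy by (auto simp: Q_def)
    have c: "x \<in> carrier R" "y \<in> carrier R" using xy by (auto simp: Q_def)
    have "(x \<oplus> y) \<ominus> (s \<oplus> t) \<otimes> r = (x \<ominus> s \<otimes> r) \<oplus> (y \<ominus> t \<otimes> r)"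
      using c Sc[OF st(1)] Sc[OF st(3)] r by algebra
    then have m: "(x \<oplus> y) \<ominus> (s \<oplus> t) \<otimes> r \<in> K" using ideal_closed(2)[OF K st(2,4)] by simp
    have "s \<oplus> t \<in> S" by (rule ideal_closed(2)[OF S st(1,3)])
    then show ?thesis
      using val[of "s \<oplus> t" "x \<oplus> y"] val[of s x] val[of t y] st c m e Sc
      by (auto simp: Q_def E.smult_l_distr)
  qed
  have Qmult: "a \<otimes> x \<in> Q \<and> \<phi> (a \<otimes> x) = a \<odot>\<^bsub>E\<^esub> \<phi> x" if x: "x \<in> Q" and a: "a \<in> carrier R" for a x
  proof -
    obtain s where s: "s \<in> S" "x \<ominus> s \<otimes> r \<in> K" and c: "x \<in> carrier R" using x by (auto simp: Q_def)
    have "a \<otimes> x \<ominus> (a \<otimes> s) \<otimes> r = a \<otimes> (x \<ominus> s \<otimes> r)"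
      using a c Sc[OF s(1)] r by algebra
    then have m: "a \<otimes> x \<ominus> (a \<otimes> s) \<otimes> r \<in> K" using ideal_closed(5)[OF K a s(2)] by simp
    have "a \<otimes> s \<in> S" by (rule ideal_closed(5)[OF S a s(1)])
    then show ?thesis
      using val[of "a \<otimes> s" "a \<otimes> x"] val[of s x] s c a m e Sc
      by (auto simp: Q_def E.smult_assoc1)
  qed
  have KQ: "x \<in> Q \<and> \<phi> x = \<zero>\<^bsub>E\<^esub>" if x: "x \<in> K" for x
  proof -
    have c: "x \<in> carrier R" using ideal_closed(7)[OF K x] .
    have "x \<ominus> \<zero> \<otimes> r \<in> K" using x c r by (simp add: a_minus_def)
    then show ?thesis using val[of \<zero> x] ideal_closed(1)[OF S] c e by (auto simp: Q_def)
  qed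
  have SQ: "s \<otimes> r \<in> Q \<and> \<phi> (s \<otimes> r) = s \<odot>\<^bsub>E\<^esub> e" if s: "s \<in> S" for s
  proof -
    have "s \<otimes> r \<ominus> s \<otimes> r \<in> K" using Sc[OF s] r ideal_closed(1)[OF K] by (simp add: a_minus_def r_neg)
    then show ?thesis using val[OF s, of "s \<otimes> r"] s Sc[OF s] r by (auto simp: Q_def)
  qed
  have Q: "ideal Q R"
    by (rule ideal_criterion) (use Qadd Qmult KQ ideal_closed(1)[OF K] in \<open>auto simp: Q_def\<close>)
  have "\<phi> x \<in> carrier E" if "x \<in> Q" for x
    using that val Sc e by (auto simp: Q_def)
  then have "\<exists>f \<in> carrier E. \<forall>x\<in>Q. \<phi> x = x \<odot>\<^bsub>E\<^esub> f"
    using Qadd Qmult by (intro injective_module_Baer[OF injective Q]) auto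
  then obtain f where "f \<in> carrier E" "\<And>x. x \<in> Q \<Longrightarrow> x \<odot>\<^bsub>E\<^esub> f = \<phi> x" by metis
  then show ?thesis using KQ SQ by (intro bexI[of _ f]) (auto simp: mod_ann_def)
qed

text \<open>The element \<open>f\<close> is chosen to be killed by \<open>A\<close> and to agree with \<open>e\<close> under multiplication by
\<open>B\<close>; on \<open>A \<inter> B\<close> these demands are consistent because \<open>e\<close> is killed there.\<close>

lemma mod_ann_Int_decompose:
  assumes A: "ideal A R" and B: "ideal B R" and e: "e \<in> mod_ann R E (A \<inter> B)"
  shows "\<exists>f \<in> mod_ann R E A. \<exists>g \<in> mod_ann R E B. e = f \<oplus>\<^bsub>E\<^esub> g"
proof -
  have ec: "e \<in> carrier E" using e by (simp add: mod_ann_def)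
  have Bc: "s \<in> carrier R" if "s \<in> B" for s using ideal_closed(7)[OF B that] .
  have "\<exists>f \<in> mod_ann R E A. \<forall>s\<in>B. (s \<otimes> \<one>) \<odot>\<^bsub>E\<^esub> f = s \<odot>\<^bsub>E\<^esub> e"
    using e Bc by (intro solve_in_injective A B ec) (auto simp: mod_ann_def)
  then obtain f where f: "f \<in> mod_ann R E A" "\<And>s. s \<in> B \<Longrightarrow> s \<odot>\<^bsub>E\<^esub> f = s \<odot>\<^bsub>E\<^esub> e"
    using Bc by auto
  have fc: "f \<in> carrier E" using f by (simp add: mod_ann_def)
  have "e \<ominus>\<^bsub>E\<^esub> f \<in> mod_ann R E B"
    using f(2) fc ec Bc
    by (auto simp: mod_ann_def a_minus_def E.smult_r_distr E.smult_r_minus E.M.r_neg)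
  moreover have "e = f \<oplus>\<^bsub>E\<^esub> (e \<ominus>\<^bsub>E\<^esub> f)"
    using fc ec by (simp add: a_minus_def E.M.a_lcomm[of f] E.M.r_neg)
  ultimately show ?thesis using f(1) by blast
qed

text \<open>Dual to the definition of the colon ideal as an intersection of the \<open>K : b\<close> over generators
\<open>b\<close> of \<open>L\<close>. For one generator, an element \<open>e\<close> killed by \<open>K : b\<close> equals \<open>b f\<close> with \<open>f\<close> killed by \<open>K\<close>;
finite intersections are handled by \<open>mod_ann_Int_decompose\<close>.\<close>

lemma mod_ann_colon:
  assumes K: "ideal K R" and L: "ideal L R"
  shows "mod_ann R E (ideal_colon R K L) = ideal_smult R E L (mod_ann R E K)"
proof
  have Kc: "K \<subseteq> carrier R" and Lc: "L \<subseteq> carrier R" using ideal_closed(7) K L by blast+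
  let ?G = "{a \<odot>\<^bsub>E\<^esub> x | a x. a \<in> L \<and> x \<in> mod_ann R E K}"
  have "?G \<subseteq> mod_ann R E (ideal_colon R K L)"
    using Lc by (auto simp: mod_ann_def ideal_colon_def E.smult_assoc1[symmetric] subset_iff)
  then show "ideal_smult R E L (mod_ann R E K) \<subseteq> mod_ann R E (ideal_colon R K L)"
    unfolding ideal_smult_def
    by (intro E.submodule_generated_least E.mod_ann_submodule) (auto simp: ideal_colon_def)
  have "?G \<subseteq> carrier E" using Lc by (auto simp: mod_ann_def)
  then have N: "submodule (ideal_smult R E L (mod_ann R E K)) R E"
    unfolding ideal_smult_def by (rule E.submodule_generated_submodule)
  have GN: "a \<odot>\<^bsub>E\<^esub> x \<in> ideal_smult R E L (mod_ann R E K)" if "a \<in> L" "x \<in> mod_ann R E K" for a x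
    using that E.submodule_generated_incl[of ?G] unfolding ideal_smult_def by blast
  have colon: "ideal (ideal_colon R K B) R" if "B \<subseteq> carrier R" for B
    using that unfolding ideal_colon_def
    by (intro ideal_criterion)
      (auto simp: l_distr m_assoc subset_iff intro: ideal_closed(1,2,5)[OF K])
  obtain B where B: "B \<subseteq> carrier R" "finite B" "L = Idl B" using finetely_gen[OF L] by blast
  have BL: "B \<subseteq> L" using genideal_self[OF B(1)] B(3) by simp
  have fin: "mod_ann R E (ideal_colon R K C) \<subseteq> ideal_smult R E L (mod_ann R E K)"
    if "finite C" "C \<subseteq> L" for C
    using that
  proof (induct C)
    case empty
    have "x = \<zero>\<^bsub>E\<^esub>" if "x \<in> mod_ann R E (ideal_colon R K {})" for x
    proof -
      have "x \<in> carrier E" "\<one> \<odot>\<^bsub>E\<^esub> x = \<zero>\<^bsub>E\<^esub>" using that by (auto simp: mod_ann_def ideal_colon_def)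
      then show ?thesis by simp
    qed
    moreover have "\<zero>\<^bsub>E\<^esub> \<in> ideal_smult R E L (mod_ann R E K)"
      using subgroup.one_closed[OF submodule.axioms(1)[OF N]] by simp
    ultimately show ?case by auto
  next
    case (insert b C)
    have b: "b \<in> L" "b \<in> carrier R" and C: "C \<subseteq> L" "C \<subseteq> carrier R" using insert.prems Lc by auto
    have split: "ideal_colon R K (insert b C) = ideal_colon R K {b} \<inter> ideal_colon R K C"
      by (auto simp: ideal_colon_def)
    have single: "mod_ann R E (ideal_colon R K {b}) \<subseteq> ideal_smult R E L (mod_ann R E K)"
    proof
      fix e assume e: "e \<in> mod_ann R E (ideal_colon R K {b})"
      then have ec: "e \<in> carrier E" by (simp add: mod_ann_def)
      have "\<exists>f \<in> mod_ann R E K. \<forall>s\<in>carrier R. (s \<otimes> b) \<odot>\<^bsub>E\<^esub> f = s \<odot>\<^bsub>E\<^esub> e"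
        using e by (intro solve_in_injective K oneideal b ec) (auto simp: mod_ann_def ideal_colon_def)
      then obtain f where "f \<in> mod_ann R E K" "(\<one> \<otimes> b) \<odot>\<^bsub>E\<^esub> f = \<one> \<odot>\<^bsub>E\<^esub> e" by blast
      then show "e \<in> ideal_smult R E L (mod_ann R E K)" using GN[OF b(1), of f] b(2) ec by simp
    qed
    show ?case
    proof
      fix e assume "e \<in> mod_ann R E (ideal_colon R K (insert b C))"
      then obtain f g where f: "f \<in> mod_ann R E (ideal_colon R K {b})"
        and g: "g \<in> mod_ann R E (ideal_colon R K C)" and e: "e = f \<oplus>\<^bsub>E\<^esub> g"
        using mod_ann_Int_decompose[OF colon colon, of "{b}" C] b(2) C(2) unfolding split by blast
      show "e \<in> ideal_smult R E L (mod_ann R E K)"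
        unfolding e using insert.hyps(3)[OF C(1)] f g single by (intro E.submoduleE(5)[OF N]) blast+
    qed
  qed
  have "ideal_colon R K B \<subseteq> ideal_colon R K L"
  proof
    fix r assume r: "r \<in> ideal_colon R K B"
    then have rc: "r \<in> carrier R" by (simp add: ideal_colon_def)
    have "r \<otimes> x \<in> K" if "x \<in> L" for x
      using Idl_mult_in_ideal[OF K rc B(1)] r that B(3) by (simp add: ideal_colon_def)
    then show "r \<in> ideal_colon R K L" using rc by (simp add: ideal_colon_def)
  qed
  then have "mod_ann R E (ideal_colon R K L) \<subseteq> mod_ann R E (ideal_colon R K B)"
    by (auto simp: mod_ann_def)
  then show "mod_ann R E (ideal_colon R K L) \<subseteq> ideal_smult R E L (mod_ann R E K)"
    using fin[OF B(2) BL] by blast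
qed

end

section \<open>The injective hull of the residue field\<close>

locale residue_field_hull = complete_noetherian_local_ring R \<mm> + E: module R E
  for R :: "('a, 'r) ring_scheme" (structure) and \<mm> and E :: "('a, 'b, 'e) module_scheme" +
  assumes hull: "injective_hull R (residue_module R \<mm>) E"

sublocale residue_field_hull \<subseteq> injective_over_noetherian R E
  by unfold_locales (use hull in \<open>simp add: injective_hull_def\<close>)

context residue_field_hull
begin

text \<open>The image of \<open>1\<close> under the embedding of the residue field spans a simple submodule, and by
essentiality this submodule meets, hence is contained in, every nonzero submodule.\<close>

lemma socle_generator:
  "\<exists>u \<in> carrier E. u \<noteq> \<zero>\<^bsub>E\<^esub> \<and> (\<forall>a\<in>\<mm>. a \<odot>\<^bsub>E\<^esub> u = \<zero>\<^bsub>E\<^esub>) \<and>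
     (\<forall>N. submodule N R E \<longrightarrow> N \<noteq> {\<zero>\<^bsub>E\<^esub>} \<longrightarrow> u \<in> N)"
proof -
  let ?K = "residue_module R \<mm>"
  obtain \<iota> where \<iota>: "essential_mono R ?K E \<iota>" using hull by (auto simp: injective_hull_def)
  interpret I: ideal \<mm> R by (rule max_ideal)
  interpret h: ring_hom_ring R "R Quot \<mm>" "(+>) \<mm>" by (rule I.rcos_ring_hom_ring)
  interpret F: field "R Quot \<mm>"
    by (rule maximalideal.quotient_is_field[OF maximal]) (rule is_cring)
  interpret K: module R ?K by (rule residue_module_module[OF is_cring max_ideal])
  have sm: "r \<odot>\<^bsub>?K\<^esub> c = (\<mm> +> r) \<otimes>\<^bsub>R Quot \<mm>\<^esub> c" for r c by (simp add: residue_module_def)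
  have cK: "carrier ?K = carrier (R Quot \<mm>)" "\<zero>\<^bsub>?K\<^esub> = \<zero>\<^bsub>R Quot \<mm>\<^esub>" by (simp_all add: residue_module_def)
  have \<iota>_hom: "\<iota> \<in> mod_hom R ?K E" and inj: "inj_on \<iota> (carrier (R Quot \<mm>))"
    using \<iota> by (simp_all add: essential_mono_def cK)
  have hom1: "\<iota> k \<in> carrier E" if "k \<in> carrier (R Quot \<mm>)" for k
    using that \<iota>_hom by (auto simp: mod_hom_def cK)
  have hom2: "\<iota> (r \<odot>\<^bsub>?K\<^esub> k) = r \<odot>\<^bsub>E\<^esub> \<iota> k" if "k \<in> carrier (R Quot \<mm>)" "r \<in> carrier R" for k r
    using that \<iota>_hom by (simp add: mod_hom_def cK)
  have "\<zero> \<odot>\<^bsub>?K\<^esub> \<zero>\<^bsub>R Quot \<mm>\<^esub> = \<zero>\<^bsub>R Quot \<mm>\<^esub>"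
    using K.smult_l_null[of "\<zero>\<^bsub>R Quot \<mm>\<^esub>"] h.S.zero_closed by (simp only: cK)
  then have \<iota>0: "\<iota> \<zero>\<^bsub>R Quot \<mm>\<^esub> = \<zero>\<^bsub>E\<^esub>"
    using hom2[OF h.S.zero_closed zero_closed] E.smult_l_null[OF hom1[OF h.S.zero_closed]] by simp
  let ?u = "\<iota> \<one>\<^bsub>R Quot \<mm>\<^esub>"
  have "?u \<noteq> \<zero>\<^bsub>E\<^esub>"
    using inj_onD[OF inj, of "\<one>\<^bsub>R Quot \<mm>\<^esub>" "\<zero>\<^bsub>R Quot \<mm>\<^esub>"] \<iota>0 F.one_not_zero by auto
  moreover have "a \<odot>\<^bsub>E\<^esub> ?u = \<zero>\<^bsub>E\<^esub>" if a: "a \<in> \<mm>" for a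
  proof -
    have ac: "a \<in> carrier R" using I.Icarr[OF a] .
    have "\<zero>\<^bsub>R Quot \<mm>\<^esub> = \<mm>" by (simp only: FactRing_def ring.simps)
    then have "a \<odot>\<^bsub>?K\<^esub> \<one>\<^bsub>R Quot \<mm>\<^esub> = \<zero>\<^bsub>R Quot \<mm>\<^esub>"
      unfolding sm h.S.r_one[OF h.hom_closed[OF ac]] by (simp only: a_rcos_zero[OF max_ideal a])
    then show ?thesis using hom2[OF h.S.one_closed ac] \<iota>0 by (simp only:)
  qed
  moreover have "?u \<in> N" if N: "submodule N R E" "N \<noteq> {\<zero>\<^bsub>E\<^esub>}" for N
  proof -
    have "N \<inter> \<iota> ` carrier (R Quot \<mm>) \<noteq> {\<zero>\<^bsub>E\<^esub>}"
      using \<iota> N unfolding essential_mono_def cK by blast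
    moreover have "\<zero>\<^bsub>E\<^esub> \<in> N"
      using subgroup.one_closed[OF submodule.axioms(1)[OF N(1)]] by simp
    moreover have "\<zero>\<^bsub>E\<^esub> \<in> \<iota> ` carrier (R Quot \<mm>)"
      using \<iota>0 h.S.zero_closed by (metis imageI)
    ultimately obtain y where y: "y \<in> N" "y \<in> \<iota> ` carrier (R Quot \<mm>)" "y \<noteq> \<zero>\<^bsub>E\<^esub>"
      by blast
    obtain k where k: "k \<in> carrier (R Quot \<mm>)" "y = \<iota> k" using y(2) by blast
    have "k \<noteq> \<zero>\<^bsub>R Quot \<mm>\<^esub>" using y(3) \<iota>0 k(2) by metis
    then have "k \<in> Units (R Quot \<mm>)" using k(1) F.field_Units by blast
    then obtain k' where k': "k' \<in> carrier (R Quot \<mm>)" "k' \<otimes>\<^bsub>R Quot \<mm>\<^esub> k = \<one>\<^bsub>R Quot \<mm>\<^esub>"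
      unfolding Units_def by blast
    have "k' \<in> a_rcosets \<mm>" using k'(1) by (simp only: FactRing_def partial_object.simps)
    then obtain s where s: "s \<in> carrier R" "k' = \<mm> +> s" unfolding A_RCOSETS_def' by blast
    have "s \<odot>\<^bsub>?K\<^esub> k = \<one>\<^bsub>R Quot \<mm>\<^esub>" unfolding sm s(2)[symmetric] by (rule k'(2))
    then have "?u = s \<odot>\<^bsub>E\<^esub> y" using hom2[OF k(1) s(1)] k(2) by (simp only:)
    then show ?thesis using E.submoduleE(4)[OF N(1) s(1) y(1)] by (simp only:)
  qed
  moreover have "?u \<in> carrier E" by (rule hom1[OF h.S.one_closed])
  ultimately show ?thesis by (intro bexI[of _ ?u] conjI ballI allI impI)
qed

text \<open>The module \<open>E\<close> is a cogenerator: if \<open>r \<notin> K\<close>, then \<open>K : r\<close> lies in \<open>\<mm>\<close> and therefore kills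
the socle generator \<open>u\<close>, so that \<open>r f = u \<noteq> 0\<close> has a solution \<open>f\<close> killed by \<open>K\<close>.\<close>

lemma ring_ann_mod_ann:
  assumes K: "ideal K R"
  shows "ring_ann R E (mod_ann R E K) = K"
proof
  show "K \<subseteq> ring_ann R E (mod_ann R E K)"
    using ideal_closed(7)[OF K] by (auto simp: ring_ann_def mod_ann_def)
  show "ring_ann R E (mod_ann R E K) \<subseteq> K"
  proof (rule subsetI, rule ccontr)
    fix r assume r: "r \<in> ring_ann R E (mod_ann R E K)" "r \<notin> K"
    then have rc: "r \<in> carrier R" by (simp add: ring_ann_def)
    obtain u where u: "u \<in> carrier E" "u \<noteq> \<zero>\<^bsub>E\<^esub>" "\<And>a. a \<in> \<mm> \<Longrightarrow> a \<odot>\<^bsub>E\<^esub> u = \<zero>\<^bsub>E\<^esub>"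
      using socle_generator by blast
    have "\<exists>f \<in> mod_ann R E K. \<forall>s\<in>carrier R. (s \<otimes> r) \<odot>\<^bsub>E\<^esub> f = s \<odot>\<^bsub>E\<^esub> u"
      using u multiplier_in_maximal[OF K rc r(2)] by (intro solve_in_injective K oneideal rc) auto
    then obtain f where "f \<in> mod_ann R E K" "(\<one> \<otimes> r) \<odot>\<^bsub>E\<^esub> f = \<one> \<odot>\<^bsub>E\<^esub> u" by blast
    then show False using r(1) rc u(1,2) by (auto simp: ring_ann_def)
  qed
qed

text \<open>A multiple \<open>r e\<close> of \<open>e\<close> is the socle generator. It is not zero, but it is killed by \<open>a\<close>, so
\<open>r\<close> kills \<open>a e\<close> and not \<open>e\<close>.\<close>

lemma annihilator_strictly_grows:
  assumes e: "e \<in> carrier E" "e \<noteq> \<zero>\<^bsub>E\<^esub>" and a: "a \<in> \<mm>"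
  shows "ring_ann R E {e} \<subset> ring_ann R E {a \<odot>\<^bsub>E\<^esub> e}"
proof -
  obtain u where u: "u \<noteq> \<zero>\<^bsub>E\<^esub>" "a \<odot>\<^bsub>E\<^esub> u = \<zero>\<^bsub>E\<^esub>"
    "\<And>N. submodule N R E \<Longrightarrow> N \<noteq> {\<zero>\<^bsub>E\<^esub>} \<Longrightarrow> u \<in> N"
    using socle_generator a by blast
  let ?N = "(\<lambda>r. r \<odot>\<^bsub>E\<^esub> e) ` carrier R"
  have "e \<in> ?N" using E.smult_one[OF e(1)] by (intro image_eqI[of _ _ \<one>]) auto
  then have "?N \<noteq> {\<zero>\<^bsub>E\<^esub>}" using e(2) by blast
  then have "u \<in> ?N" by (rule u(3)[OF E.cyclic_submodule[OF e(1)]])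
  then obtain r where r: "r \<in> carrier R" "u = r \<odot>\<^bsub>E\<^esub> e" by blast
  have ac: "a \<in> carrier R" using ideal_closed(7)[OF max_ideal a] .
  have comm: "b \<odot>\<^bsub>E\<^esub> (a \<odot>\<^bsub>E\<^esub> e) = a \<odot>\<^bsub>E\<^esub> (b \<odot>\<^bsub>E\<^esub> e)" if "b \<in> carrier R" for b
    by (rule E.smult_left_commute[OF that ac e(1)])
  have "ring_ann R E {e} \<subseteq> ring_ann R E {a \<odot>\<^bsub>E\<^esub> e}"
    using comm E.smult_r_null[OF ac] by (auto simp: ring_ann_def)
  moreover have "r \<in> ring_ann R E {a \<odot>\<^bsub>E\<^esub> e}"
    using comm[OF r(1)] r u(2) by (simp add: ring_ann_def)
  moreover have "r \<notin> ring_ann R E {e}" using r(2) u(1) by (simp add: ring_ann_def)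
  ultimately show ?thesis by blast
qed

text \<open>One exponent serves for finitely many elements \<open>a\<close>, in particular for generators of \<open>\<mm>\<close>,
and then the next power of \<open>\<mm>\<close> kills \<open>e\<close>.\<close>

lemma power_torsion_step:
  assumes e: "e \<in> carrier E"
    and ex: "\<And>a. a \<in> \<mm> \<Longrightarrow> \<exists>t. ideal_pow R \<mm> t \<subseteq> ring_ann R E {a \<odot>\<^bsub>E\<^esub> e}"
  shows "\<exists>t. ideal_pow R \<mm> t \<subseteq> ring_ann R E {e}"
proof -
  obtain A where A: "A \<subseteq> carrier R" "finite A" "\<mm> = Idl A" using finetely_gen[OF max_ideal] by blast
  have Am: "A \<subseteq> \<mm>" using genideal_self[OF A(1)] A(3) by simp
  have "\<exists>t. \<forall>a\<in>B. ideal_pow R \<mm> t \<subseteq> ring_ann R E {a \<odot>\<^bsub>E\<^esub> e}" if "finite B" "B \<subseteq> \<mm>" for B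
    using that
  proof (induct B)
    case (insert b B)
    then obtain t s where ts: "\<forall>a\<in>B. ideal_pow R \<mm> t \<subseteq> ring_ann R E {a \<odot>\<^bsub>E\<^esub> e}"
      "ideal_pow R \<mm> s \<subseteq> ring_ann R E {b \<odot>\<^bsub>E\<^esub> e}" using ex[of b] by auto
    have "ideal_pow R \<mm> (max s t) \<subseteq> ideal_pow R \<mm> t" "ideal_pow R \<mm> (max s t) \<subseteq> ideal_pow R \<mm> s"
      by (simp_all add: ideal_pow_antimono max_ideal)
    then have "\<forall>a\<in>insert b B. ideal_pow R \<mm> (max s t) \<subseteq> ring_ann R E {a \<odot>\<^bsub>E\<^esub> e}"
      using ts by blast
    then show ?case by (rule exI)
  qed simp
  from this[OF A(2) Am] obtain t
    where t: "\<And>a. a \<in> A \<Longrightarrow> ideal_pow R \<mm> t \<subseteq> ring_ann R E {a \<odot>\<^bsub>E\<^esub> e}" by blast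
  have ann: "ideal (ring_ann R E {e}) R" using e by (intro E.ring_ann_ideal) simp
  have "b \<otimes> a \<in> ring_ann R E {e}" if b: "b \<in> ideal_pow R \<mm> t" and a: "a \<in> \<mm>" for a b
  proof -
    have bc: "b \<in> carrier R" using ideal_closed(7)[OF ideal_pow_ideal[OF max_ideal] b] .
    show ?thesis
    proof (rule Idl_mult_in_ideal[OF ann bc A(1)])
      fix a assume a: "a \<in> A"
      then have ac: "a \<in> carrier R" using A(1) by blast
      have "b \<odot>\<^bsub>E\<^esub> (a \<odot>\<^bsub>E\<^esub> e) = \<zero>\<^bsub>E\<^esub>" using t[OF a] b unfolding ring_ann_def by blast
      then show "b \<otimes> a \<in> ring_ann R E {e}"
        using E.smult_assoc1[OF bc ac e] m_closed[OF bc ac] by (simp add: ring_ann_def)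
    qed (use a A(3) in simp)
  qed
  then have "ideal_pow R \<mm> (Suc t) \<subseteq> ring_ann R E {e}"
    unfolding ideal_pow_Suc by (intro ideal_prod_subset ann)
  then show ?thesis by (rule exI)
qed

text \<open>Noetherian induction on the annihilator of \<open>e\<close>, which grows when \<open>e\<close> is replaced by \<open>a e\<close> with
\<open>a \<in> \<mm>\<close>.\<close>

lemma power_torsion:
  assumes "e \<in> carrier E"
  shows "\<exists>t. \<forall>a\<in>ideal_pow R \<mm> t. a \<odot>\<^bsub>E\<^esub> e = \<zero>\<^bsub>E\<^esub>"
proof -
  have ideal: "ideal (ring_ann R E {e}) R" if "e \<in> carrier E" for e
    using that by (intro E.ring_ann_ideal) simp
  have "\<forall>e \<in> carrier E. ring_ann R E {e} = Q \<longrightarrow> (\<exists>t. ideal_pow R \<mm> t \<subseteq> ring_ann R E {e})"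
    if "ideal Q R" for Q
    using that
  proof (induct Q rule: noetherian_induct)
    case (step Q)
    show ?case
    proof (intro ballI impI)
      fix e assume e: "e \<in> carrier E" and Q: "ring_ann R E {e} = Q"
      show "\<exists>t. ideal_pow R \<mm> t \<subseteq> ring_ann R E {e}"
      proof (cases "e = \<zero>\<^bsub>E\<^esub>")
        case True
        have "ideal_pow R \<mm> 0 \<subseteq> ring_ann R E {\<zero>\<^bsub>E\<^esub>}" by (auto simp: ring_ann_def)
        then show ?thesis unfolding True by (rule exI)
      next
        case False
        show ?thesis
        proof (rule power_torsion_step[OF e])
          fix a assume a: "a \<in> \<mm>"
          have ae: "a \<odot>\<^bsub>E\<^esub> e \<in> carrier E" using ideal_closed(7)[OF max_ideal a] e by simp
          show "\<exists>t. ideal_pow R \<mm> t \<subseteq> ring_ann R E {a \<odot>\<^bsub>E\<^esub> e}"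
            using step(2)[OF ideal[OF ae]] annihilator_strictly_grows[OF e False a] ae unfolding Q by blast
        qed
      qed
    qed
  qed
  then obtain t where "ideal_pow R \<mm> t \<subseteq> ring_ann R E {e}" using ideal[OF assms] assms by blast
  then show ?thesis by (auto simp: ring_ann_def)
qed

text \<open>Krull's intersection theorem for \<open>R / K\<close>, by duality: an element of the closure of \<open>K\<close>
kills everything in \<open>0 :\<^sub>E K\<close>, since each such element is killed by \<open>K\<close> and by a power of \<open>\<mm>\<close>.\<close>

lemma ideal_closed_in_adic_topology:
  assumes K: "ideal K R" and x: "x \<in> carrier R" "\<And>t. x \<in> K <+> ideal_pow R \<mm> t"
  shows "x \<in> K"
proof -
  have "x \<odot>\<^bsub>E\<^esub> e = \<zero>\<^bsub>E\<^esub>" if e: "e \<in> mod_ann R E K" for e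
  proof -
    have ec: "e \<in> carrier E" using e by (simp add: mod_ann_def)
    obtain t where t: "\<And>a. a \<in> ideal_pow R \<mm> t \<Longrightarrow> a \<odot>\<^bsub>E\<^esub> e = \<zero>\<^bsub>E\<^esub>" using power_torsion[OF ec] by blast
    obtain p q where pq: "p \<in> K" "q \<in> ideal_pow R \<mm> t" "x = p \<oplus> q"
      using mem_sum_ideals[THEN iffD1, OF x(2)] by blast
    have "p \<in> carrier R" "q \<in> carrier R"
      using ideal_closed(7)[OF K pq(1)] ideal_closed(7)[OF ideal_pow_ideal[OF max_ideal] pq(2)] by auto
    then show ?thesis using pq t e ec by (simp add: E.smult_l_distr mod_ann_def)
  qed
  then show ?thesis using x(1) ring_ann_mod_ann[OF K] by (auto simp: ring_ann_def)
qed

text \<open>This expresses that the annihilator in \<open>E\<close> of a directed intersection is the union of the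
annihilators of the members. Modulo a power of \<open>\<mm>\<close> that kills \<open>e\<close>, some member is contained in the
intersection.\<close>

lemma annihilated_by_directed_Inter:
  assumes S: "\<And>P. P \<in> S \<Longrightarrow> ideal P R" "S \<noteq> {}"
    and dir: "\<And>A B. A \<in> S \<Longrightarrow> B \<in> S \<Longrightarrow> \<exists>C\<in>S. C \<subseteq> A \<inter> B"
    and e: "e \<in> mod_ann R E (\<Inter>S)"
  shows "\<exists>P\<in>S. e \<in> mod_ann R E P"
proof -
  have ec: "e \<in> carrier E" using e by (simp add: mod_ann_def)
  obtain t where t: "\<And>a. a \<in> ideal_pow R \<mm> t \<Longrightarrow> a \<odot>\<^bsub>E\<^esub> e = \<zero>\<^bsub>E\<^esub>" using power_torsion[OF ec] by blast
  have "\<exists>P\<in>S. P \<subseteq> \<Inter>S <+> ideal_pow R \<mm> t"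
    by (rule directed_family_member_in_neighbourhood[OF S dir]) (use ideal_closed_in_adic_topology S in auto)
  then obtain P where P: "P \<in> S" "P \<subseteq> \<Inter>S <+> ideal_pow R \<mm> t" by blast
  have "y \<odot>\<^bsub>E\<^esub> e = \<zero>\<^bsub>E\<^esub>" if y: "y \<in> P" for y
  proof -
    obtain p q where pq: "p \<in> \<Inter>S" "q \<in> ideal_pow R \<mm> t" "y = p \<oplus> q"
      using mem_sum_ideals[THEN iffD1, OF subsetD[OF P(2) y]] by blast
    have "p \<in> carrier R" "q \<in> carrier R"
      using pq(1) ideal_closed(7)[OF S(1)[OF P(1)]] P(1)
        ideal_closed(7)[OF ideal_pow_ideal[OF max_ideal] pq(2)] by auto
    moreover have "p \<odot>\<^bsub>E\<^esub> e = \<zero>\<^bsub>E\<^esub>" using e pq(1) unfolding mod_ann_def by blast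
    ultimately show ?thesis using pq t ec by (simp add: E.smult_l_distr)
  qed
  then show ?thesis using P(1) ec by (auto simp: mod_ann_def)
qed

end

section \<open>The integral hull as the annihilator of the core\<close>

context residue_field_hull
begin

text \<open>For one inclusion, each submodule contributing to the hull is killed by a reduction of \<open>I\<close>,
its annihilator. For the other, the ideals whose annihilators lie in the hull form a directed family
that contains all reductions, so its intersection is contained in the core.\<close>

lemma integral_hull_eq_core_annihilator:
  assumes I: "ideal I R"
  shows "integral_hull R E (mod_ann R E I) = mod_ann R E (core R I)"
proof
  let ?A = "mod_ann R E I"
  let ?T = "{C. submodule C R E \<and> ?A \<subseteq> C \<and> integral_interior R E C = integral_interior R E ?A}"
  let ?H = "integral_hull R E ?A"
  have Hdef: "?H = submodule_generated R E (\<Union>?T)" by (simp add: integral_hull_def)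
  have "\<Union>?T \<subseteq> carrier E" using E.submoduleE(1) by blast
  then have H: "submodule ?H R E" unfolding Hdef by (rule E.submodule_generated_submodule)
  have coreI: "core R I \<subseteq> I" using reduction_refl[OF I] by (auto simp: core_def)
  have corec: "core R I \<subseteq> carrier R" using coreI ideal_closed(7)[OF I] by blast
  have interior: "integral_interior R E ?A = mod_ann R E (integral_closure R I)"
    by (simp add: integral_interior_def ring_ann_mod_ann[OF I])
  show "?H \<subseteq> mod_ann R E (core R I)"
    unfolding Hdef
  proof (intro E.submodule_generated_least E.mod_ann_submodule[OF corec] Union_least)
    fix C assume "C \<in> ?T"
    then have C: "submodule C R E" "?A \<subseteq> C" "integral_interior R E C = integral_interior R E ?A" by auto
    let ?K = "ring_ann R E C"
    note K = E.ring_ann_ideal[OF E.submoduleE(1)[OF C(1)]]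
    have KI: "?K \<subseteq> I" using C(2) ring_ann_mod_ann[OF I] by (auto simp: ring_ann_def)
    \<comment> \<open>equal interiors force equal integral closures, as both closures are ideals\<close>
    have "integral_closure R ?K = ring_ann R E (integral_interior R E C)"
      unfolding integral_interior_def by (rule ring_ann_mod_ann[OF integral_closure_ideal[OF K], symmetric])
    also have "\<dots> = integral_closure R I"
      unfolding C(3) interior by (rule ring_ann_mod_ann[OF integral_closure_ideal[OF I]])
    finally have "I \<subseteq> integral_closure R ?K"
      using integral_over_reduction[OF reduction_refl[OF I] I] by blast
    then have "reduction R ?K I" by (rule reduction_if_integral[OF K I KI])
    then have "core R I \<subseteq> ?K" by (auto simp: core_def)
    then show "C \<subseteq> mod_ann R E (core R I)"
      using E.submoduleE(1)[OF C(1)] by (auto simp: ring_ann_def mod_ann_def)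
  qed
  show "mod_ann R E (core R I) \<subseteq> ?H"
  proof
    fix e assume e: "e \<in> mod_ann R E (core R I)"
    define S where "S = {F. ideal F R \<and> mod_ann R E F \<subseteq> ?H}"
    have red: "K \<in> S" if K: "reduction R K I" for K
    proof -
      have Ki: "ideal K R" "K \<subseteq> I" using K by (auto simp: reduction_def)
      have "mod_ann R E K \<in> ?T"
        using E.mod_ann_submodule[of K] Ki ideal_closed(7)[OF Ki(1)] interior
          integral_closure_reduction[OF K I] ring_ann_mod_ann[OF Ki(1)]
        by (auto simp: integral_interior_def) (auto simp: mod_ann_def)
      then show ?thesis
        using E.submodule_generated_incl[of "\<Union>?T"] Ki(1) unfolding S_def Hdef by blast
    qed
    have "\<exists>C\<in>S. C \<subseteq> A \<inter> B" if "A \<in> S" "B \<in> S" for A B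
    proof (intro bexI)
      have AB: "ideal A R" "ideal B R" "mod_ann R E A \<subseteq> ?H" "mod_ann R E B \<subseteq> ?H"
        using that by (auto simp: S_def)
      have "mod_ann R E (A \<inter> B) \<subseteq> ?H"
        using mod_ann_Int_decompose[OF AB(1,2)] AB(3,4) E.submoduleE(5)[OF H] by blast
      then show "A \<inter> B \<in> S" using i_intersect[OF AB(1,2)] by (simp add: S_def)
    qed simp
    moreover have "e \<in> mod_ann R E (\<Inter>S)"
      using e red by (auto simp: mod_ann_def core_def)
    moreover have "S \<noteq> {}" using red[OF reduction_refl[OF I]] by blast
    ultimately obtain P where "P \<in> S" "e \<in> mod_ann R E P"
      using annihilated_by_directed_Inter[of S e] by (auto simp: S_def)
    then show "e \<in> ?H" by (auto simp: S_def)
  qed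
qed

end

theorem theorem7p9:
  fixes R :: "('a, 'r) ring_scheme" and E :: "('a, 'b, 'e) module_scheme"
    and \<mm> I J :: "'a set" and n :: nat
  assumes "complete_noetherian_local_ring R \<mm>"
    and "injective_hull R (residue_module R \<mm>) E"
    and "ideal I R"
    and "reduction R J I"
    and "core R I = ideal_colon R (ideal_pow R J (n + 1)) (ideal_pow R I n)"
  shows "integral_hull R E (mod_ann R E I) =
    ideal_smult R E (ideal_pow R I n) (mod_ann R E (ideal_pow R J (n + 1)))"
proof -
  interpret complete_noetherian_local_ring R \<mm> by fact
  have "module R E" using assms(2) by (simp add: injective_hull_def injective_module_def)
  then interpret residue_field_hull R \<mm> E
    by (intro residue_field_hull.intro residue_field_hull_axioms.intro assms)
  have J: "ideal J R" using assms(4) by (simp add: reduction_def)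
  show ?thesis
    unfolding integral_hull_eq_core_annihilator[OF assms(3)] assms(5)
    by (rule mod_ann_colon[OF ideal_pow_ideal[OF J] ideal_pow_ideal[OF assms(3)]])
qed

end
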